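(* Let $K$ be a two-bridge link (or knot), and let its Conway polynomial, of degree $m$ and leading coefficient $c_m$, be written in the Fibonacci basis as $$\nabla_K=c_m\left(\sum_{i=0}^{\lfloor m/2\rfloor}(-1)^i\alpha_i f_{m-2i+1}\right),\qquad \alpha_0=1.$$ Then: 1. $\alpha_j\ge0$ for $j=0,\dots,\lfloor m/2\rfloor$. 2. If $\alpha_i=0$ for some $i>0$, then $\alpha_j=0$ for all $j\ge i$ (with $j\le\lfloor m/2\rfloor$).
   Context: Fibonacci polynomials: $f_0=0$, $f_1=1$, $f_{n+2}(z)=z f_{n+1}(z)+f_n(z)$. The $\alpha_i$ are rational numbers. Extended Euler continuant polynomials: for integers $b_1,\dots,b_m$, $D_m(b_1,\dots,b_m)(z)$ is defined by $D_{-1}=0$, $D_0=1$, $D_k=b_k z D_{k-1}+D_{k-2}$. Two-bridge links: for nonzero integers $b_1,\dots,b_m$ ($m\ge 0$), $C(2b_1,-2b_2,\dots,(-1)^{m-1}2b_m)$ denotes the two-bridge link in Conway normal form with these numbers of signed crossings in its successive twist regions (its Schubert fraction is the continued fraction $[2b_1,-2b_2,\dots,(-1)^{m-1}2b_m]$, where $[a_1,\dots,a_n]=a_1+1/(a_2+1/(\cdots+1/a_n))$), oriented so that the two strands of each twist region are antiparallel (it bounds the linear plumbing of $m$ unknotted annuli with $|b_1|,\dots,|b_m|$ full twists). Every oriented two-bridge link is of this form. The Conway polynomial of an oriented link is defined by $\nabla_{\text{unknot}}=1$ and $\nabla_{L_+}-\nabla_{L_-}=z\nabla_{L_0}$. It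 is known (Siebenmann; Cromwell) that the Conway polynomial of $C(2b_1,-2b_2,\dots,(-1)^{m-1}2b_m)$ is $D_m(b_1,\dots,b_m)(z)$; in particular it has degree $m$, leading coefficient $c_m=b_1\cdots b_m\neq0$, and only terms $z^{m-2k}$. *)

theory Defs
  imports Main "HOL.Rat" "HOL-Computational_Algebra.Polynomial"
begin

text \<open>
  Oriented links are presented by oriented link diagrams in Morse position, read from bottom to
  top, up to planar isotopy and Reidemeister moves.  A horizontal line meets a diagram in a row of
  strands, recorded as a list of orientations (\<open>True\<close> = upward, \<open>False\<close> = downward).  A pair
  \<open>(i, g)\<close> is a slice of the diagram with \<open>g\<close> as its only event, having \<open>i\<close> vertical strands to
  its left:

  \<^item> \<open>Cup d\<close> is a local minimum; its left leg has orientation \<open>d\<close>, its right leg \<open>\<not> d\<close>.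
  \<^item> \<open>Cap\<close> is a local maximum.
  \<^item> \<open>Cross e\<close> is a crossing; the strand from bottom left to top right passes over iff \<open>e\<close>.
\<close>

datatype event = Cup bool | Cap | Cross bool

type_synonym diagram = "(nat \<times> event) list"

inductive slice :: "bool list \<Rightarrow> nat \<times> event \<Rightarrow> bool list \<Rightarrow> bool" where
  "slice (u @ v) (length u, Cup d) (u @ [d, \<not> d] @ v)"
| "slice (u @ [d, \<not> d] @ v) (length u, Cap) (u @ v)"
| "slice (u @ [a, b] @ v) (length u, Cross e) (u @ [b, a] @ v)"

inductive tangle :: "bool list \<Rightarrow> diagram \<Rightarrow> bool list \<Rightarrow> bool" where
  "tangle s [] s"
| "slice s x t \<Longrightarrow> tangle t D r \<Longrightarrow> tangle s (x # D) r"

definition link_diagram :: "diagram \<Rightarrow> bool" where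
  "link_diagram D \<longleftrightarrow> tangle [] D []"

fun legs_below :: "event \<Rightarrow> nat" where
  "legs_below (Cup d) = 0"
| "legs_below Cap = 2"
| "legs_below (Cross e) = 2"

fun legs_above :: "event \<Rightarrow> nat" where
  "legs_above (Cup d) = 2"
| "legs_above Cap = 0"
| "legs_above (Cross e) = 2"

text \<open>
  The local moves: the first five rules generate planar isotopy of diagrams, the remaining ones are
  the Reidemeister moves.  In the third
  Reidemeister move \<open>e\<close>, \<open>f\<close>, \<open>g\<close> record which strand is on top for the pairs (1,2), (1,3), (2,3) of
  the three strands involved, counted from the left at the bottom; the side condition says that
  these choices are not cyclic, so that one strand is above and one below the two others.
\<close>

inductive local_move :: "diagram \<Rightarrow> diagram \<Rightarrow> bool" where
  far_commute:
    "local_move [(i, x), (i + legs_above x + k, y)] [(i + legs_below x + k, y), (i, x)]"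
| straighten_left: "local_move [(i, Cup d), (i + 1, Cap)] []"
| straighten_right: "local_move [(i + 1, Cup d), (i, Cap)] []"
| slide_cup:
    "local_move [(i, Cup d), (i + 1, Cross e)] [(i + 1, Cup d), (i, Cross (\<not> e))]"
| slide_cap:
    "local_move [(i + 1, Cross e), (i, Cap)] [(i, Cross (\<not> e)), (i + 1, Cap)]"
| R1_cup: "local_move [(i, Cup d), (i, Cross e)] [(i, Cup (\<not> d))]"
| R1_cap: "local_move [(i, Cross e), (i, Cap)] [(i, Cap)]"
| R2: "local_move [(i, Cross e), (i, Cross (\<not> e))] []"
| R3: "f = e \<or> f = g \<Longrightarrow>
    local_move [(i, Cross e), (i + 1, Cross f), (i, Cross g)]
               [(i + 1, Cross g), (i, Cross f), (i + 1, Cross e)]"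

text \<open>
  A local move between two link diagrams is always compatible with the orientations, because both
  sides are required to be oriented diagrams with the same slices outside the move.
\<close>

inductive diagram_move :: "diagram \<Rightarrow> diagram \<Rightarrow> bool" where
  "local_move L R \<Longrightarrow> link_diagram (E @ L @ F) \<Longrightarrow> link_diagram (E @ R @ F) \<Longrightarrow>
   diagram_move (E @ L @ F) (E @ R @ F)"

definition isotopic :: "diagram \<Rightarrow> diagram \<Rightarrow> bool" where
  "isotopic = equivclp diagram_move"

text \<open>
  For strands with orientations \<open>a\<close> (bottom left to top right) and \<open>b\<close> (bottom right to top left),
  the crossing \<open>Cross e\<close> is positive iff \<open>e = (a = b)\<close>.  The orientation-respecting smoothing is
  a pair of vertical strands if \<open>a = b\<close>, and otherwise a maximum below a minimum.
\<close>

inductive skein_triple :: "diagram \<Rightarrow> diagram \<Rightarrow> diagram \<Rightarrow> bool" where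
  "tangle [] E (u @ [a, b] @ v) \<Longrightarrow> tangle (u @ [b, a] @ v) F [] \<Longrightarrow>
   skein_triple
     (E @ [(length u, Cross (a = b))] @ F)
     (E @ [(length u, Cross (a \<noteq> b))] @ F)
     (E @ (if a = b then [] else [(length u, Cap), (length u, Cup b)]) @ F)"

definition unknot :: diagram where
  "unknot = [(0, Cup True), (0, Cap)]"

text \<open>
  The axioms characterising the Conway polynomial.  They determine its values on all diagrams of
  nonempty links; only the value on the empty diagram is left open.
\<close>

definition conway_polynomial :: "(diagram \<Rightarrow> int poly) \<Rightarrow> bool" where
  "conway_polynomial nabla \<longleftrightarrow>
     (\<forall>D D'. link_diagram D \<and> isotopic D D' \<longrightarrow> nabla D = nabla D') \<and>
     nabla unknot = 1 \<and>
     (\<forall>Lp Lm L0. skein_triple Lp Lm L0 \<longrightarrow> nabla Lp - nabla Lm = [:0, 1:] * nabla L0)"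

text \<open>
  Two-bridge links are the links that have a diagram with exactly two local maxima.  This includes
  the unknot (the Conway normal form without twist regions) and the two-component unlink, whose Conway polynomial is zero.
\<close>

definition maxima :: "diagram \<Rightarrow> nat" where
  "maxima D = length (filter (\<lambda>(i, x). x = Cap) D)"

definition two_bridge :: "diagram \<Rightarrow> bool" where
  "two_bridge K \<longleftrightarrow> link_diagram K \<and> (\<exists>D. isotopic K D \<and> maxima D = 2)"

fun fib_poly :: "nat \<Rightarrow> rat poly" where
  "fib_poly 0 = 0"
| "fib_poly (Suc 0) = 1"
| "fib_poly (Suc (Suc n)) = [:0, 1:] * fib_poly (Suc n) + fib_poly n"

end

theory Submission
  imports Defs
begin

text \<open>
  The proof has a topological and an arithmetic half, joined by the continuants
  \<open>D(b, b', \<dots>) = b z D(b', \<dots>) + D(\<dots>)\<close>.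

  \<^bold>\<open>Topology.\<close>  The Conway polynomial of a two-bridge link is zero or a continuant with
  nonzero entries.  Instead of bringing a diagram into a normal form, the proof reads it from
  bottom to top and evaluates it linearly.  Where a diagram with two maxima is four strands wide,
  the skein relation makes the part below a horizontal line equivalent to a combination
  \<open>p X + q Y\<close> of two fixed simple tangles, which depend only on the orientations of the four ends.
  With a suitable choice of \<open>X\<close> and \<open>Y\<close>, a further crossing changes \<open>(p, q)\<close> only by exchanging
  the entries and by adding \<open>k z\<close> times one entry to the other.  There are just two geometric
  reasons.  A crossing of antiparallel strands takes \<open>X\<close> and \<open>Y\<close> to the basic tangles of the new
  ends, up to a multiple of the smoothing; up to exchanging the roles of the two tangles, the
  smoothing turns \<open>Y\<close> into the new \<open>X\<close> and splits a circle off \<open>X\<close> (\<open>expands_antiparallel\<close>).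
  A crossing of parallel strands exchanges \<open>X\<close> and \<open>Y\<close>, again up to a multiple of the smoothing
  (\<open>expands_parallel\<close>).  When the diagram is closed at the top, one of \<open>X\<close>, \<open>Y\<close> becomes the
  unknot and the other an unlink of two components, so that the polynomial is \<open>p\<close> or \<open>q\<close>
  (\<open>two_bridge_reachable\<close>).  The pairs obtained from \<open>(1, 0)\<close> in this way are, up to exchanging
  the entries, pairs of consecutive continuants: adding \<open>k z\<close> times the second entry to the first
  either prepends \<open>k\<close> to the list or adds \<open>k\<close> to its head, and a head that becomes zero can be
  dropped (\<open>reachable_continuant_pair\<close>).

  \<^bold>\<open>Arithmetic.\<close>  Since \<open>z f\<^sub>n = f\<^sub>n\<^sub>+\<^sub>1 - f\<^sub>n\<^sub>-\<^sub>1\<close>, dividing continuants by their leading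
  coefficients turns their recursion into
  \<open>a\<^sub>i = a'\<^sub>i + a'\<^sub>i\<^sub>-\<^sub>1 - a''\<^sub>i\<^sub>-\<^sub>1 / (b b')\<close> for the alternating Fibonacci coefficients of
  three consecutive continuants.  As \<open>b\<close> and \<open>b'\<close> are nonzero integers, \<open>1 / (b b') \<le> 1\<close>, and
  the inequalities \<open>0 \<le> a'' \<le> a' \<le> a\<close> propagate along the recursion (\<open>fib_coeff_mono\<close>).  This
  gives nonnegativity, and also the second claim: if \<open>a\<^sub>i\<close> vanishes, so does \<open>a'\<^sub>i\<close>, hence
  inductively all \<open>a'\<^sub>j\<close> with \<open>j \<ge> i\<close>, which bound the corresponding \<open>a''\<^sub>j\<close>
  (\<open>fib_coeff_zero_tail\<close>).
\<close>

section \<open>Fibonacci coefficients of continuants\<close>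

text \<open>
  These are the extended Euler continuants with the list reversed: the head of the list is the
  entry that enters the recursion last.
\<close>

fun continuant :: "int list \<Rightarrow> int poly" where
  "continuant [] = 1"
| "continuant [b] = [:0, b:]"
| "continuant (b # b' # bs) = [:0, b:] * continuant (b' # bs) + continuant bs"

lemma continuant_top_coeff:
  "degree (continuant bs) \<le> length bs \<and> coeff (continuant bs) (length bs) = prod_list bs"
proof (induction bs rule: continuant.induct)
  case (3 b b' bs)
  have "degree ([:0, b:] * continuant (b' # bs)) \<le> Suc (length (b' # bs))"
    using 3 degree_mult_le[of "[:0, b:]" "continuant (b' # bs)"]
    by (auto intro: order.trans simp: degree_pCons_eq_if split: if_splits)
  moreover have "degree (continuant bs) \<le> Suc (length bs)"
    using 3 by simp
  ultimately show ?case
    using 3 by (auto intro!: degree_add_le simp: coeff_eq_0)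
qed (auto simp: degree_pCons_eq_if)

lemma continuant_degree_lead_coeff:
  assumes "0 \<notin> set bs"
  shows "degree (continuant bs) = length bs" "lead_coeff (continuant bs) = prod_list bs"
proof -
  have "coeff (continuant bs) (length bs) \<noteq> 0"
    using assms by (simp add: continuant_top_coeff prod_list_zero_iff)
  then show *: "degree (continuant bs) = length bs"
    using continuant_top_coeff[of bs] by (simp add: le_antisym le_degree)
  show "lead_coeff (continuant bs) = prod_list bs"
    by (simp add: * continuant_top_coeff)
qed

text \<open>
  The truncation at half the length reflects \<open>f\<^sub>0 = 0\<close>: for lists of odd length, the recursion
  alone would produce one more coefficient, belonging to \<open>f\<^sub>0\<close>.
\<close>

fun fib_coeff :: "int list \<Rightarrow> nat \<Rightarrow> rat" where
  "fib_coeff [] i = (if i = 0 then 1 else 0)"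
| "fib_coeff [b] i = (if i = 0 then 1 else 0)"
| "fib_coeff (b # b' # bs) i =
     (if i = 0 then 1
      else if 2 * i \<le> length (b # b' # bs) then
        fib_coeff (b' # bs) i + fib_coeff (b' # bs) (i - 1)
          - fib_coeff bs (i - 1) / of_int (b * b')
      else 0)"

lemma fib_coeff_0 [simp]: "fib_coeff bs 0 = 1"
  by (induction bs rule: continuant.induct) auto

lemma fib_coeff_eq_0: "length bs < 2 * i \<Longrightarrow> fib_coeff bs i = 0"
  by (induction bs rule: continuant.induct) auto

text \<open>
  For either sign of \<open>b b'\<close>, the subtracted term is at most \<open>a''\<^sub>i\<^sub>-\<^sub>1 \<le> a'\<^sub>i\<^sub>-\<^sub>1\<close>, so it never
  outweighs the term \<open>a'\<^sub>i\<^sub>-\<^sub>1\<close> that is added.  Proving monotonicity and nonnegativity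
  together makes the induction close.
\<close>

lemma fib_coeff_mono:
  assumes "0 \<notin> set bs"
  shows "0 \<le> fib_coeff bs i \<and> fib_coeff (tl bs) i \<le> fib_coeff bs i"
  using assms
proof (induction bs arbitrary: i rule: continuant.induct)
  case (3 b b' bs)
  note IH = "3.IH"(1)
  have step: "fib_coeff (b' # bs) i \<le> fib_coeff (b # b' # bs) i"
  proof (cases "i \<noteq> 0 \<and> 2 * i \<le> length (b # b' # bs)")
    case True
    have nonneg: "0 \<le> fib_coeff bs (i - 1)" "fib_coeff bs (i - 1) \<le> fib_coeff (b' # bs) (i - 1)"
      using 3 by auto
    have "1 \<le> \<bar>b * b'\<bar>"
      using 3 by (simp add: int_one_le_iff_zero_less)
    then have "1 \<le> \<bar>rat_of_int (b * b')\<bar>"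
      by (metis of_int_1_le_iff of_int_abs)
    then have "fib_coeff bs (i - 1) / \<bar>rat_of_int (b * b')\<bar> \<le> fib_coeff bs (i - 1) / 1"
      using nonneg by (intro divide_left_mono) auto
    moreover have "fib_coeff bs (i - 1) / rat_of_int (b * b')
        \<le> fib_coeff bs (i - 1) / \<bar>rat_of_int (b * b')\<bar>"
      using nonneg(1) by (metis abs_divide abs_ge_self abs_of_nonneg)
    ultimately have "fib_coeff bs (i - 1) / rat_of_int (b * b') \<le> fib_coeff (b' # bs) (i - 1)"
      using nonneg by linarith
    then show ?thesis
      using True by auto
  next
    case False
    then show ?thesis
      by (auto simp: fib_coeff_eq_0)
  qed
  moreover have "0 \<le> fib_coeff (b' # bs) i"
    using 3 by auto
  ultimately show ?case
    by simp
qed auto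

text \<open>
  In the recursion for \<open>a\<^sub>j\<close> with \<open>j > i\<close>, the terms \<open>a'\<^sub>j\<close> and \<open>a'\<^sub>j\<^sub>-\<^sub>1\<close> vanish by
  induction, because \<open>a'\<^sub>i \<le> a\<^sub>i = 0\<close>; the third one, of index \<open>j - 1 \<ge> i\<close>, is squeezed between
  zero and \<open>a'\<^sub>j\<^sub>-\<^sub>1\<close>.
\<close>

lemma fib_coeff_zero_tail:
  assumes "0 \<notin> set bs" "fib_coeff bs i = 0" "i \<le> j"
  shows "fib_coeff bs j = 0"
  using assms
proof (induction bs arbitrary: i j rule: continuant.induct)
  case (3 b b' bs)
  have "i \<noteq> 0"
    using "3.prems"(2) by (metis fib_coeff_0 zero_neq_one)
  show ?case
  proof (cases "i = j \<or> length (b # b' # bs) < 2 * j")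
    case True
    then show ?thesis
      using "3.prems"(2) by (metis fib_coeff_eq_0)
  next
    case False
    then have "i \<le> j - 1" "j \<noteq> 0"
      using \<open>i \<le> j\<close> by auto
    have nz: "0 \<notin> set (b' # bs)" "0 \<notin> set bs"
      using "3.prems"(1) by auto
    have "fib_coeff (b' # bs) i \<le> 0"
      using fib_coeff_mono[OF "3.prems"(1), of i] unfolding "3.prems"(2) by simp
    then have "fib_coeff (b' # bs) i = 0"
      using fib_coeff_mono[OF nz(1), of i] by (intro order.antisym) auto
    then have zero: "fib_coeff (b' # bs) k = 0" if "i \<le> k" for k
      using "3.IH"(1) nz(1) that by blast
    have "fib_coeff bs (j - 1) \<le> 0"
      using fib_coeff_mono[OF nz(1), of "j - 1"] zero[OF \<open>i \<le> j - 1\<close>] by simp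
    then have "fib_coeff bs (j - 1) = 0"
      using fib_coeff_mono[OF nz(2), of "j - 1"] by (intro order.antisym) auto
    then show ?thesis
      using zero[of j] zero[of "j - 1"] \<open>i \<le> j\<close> \<open>i \<le> j - 1\<close> \<open>j \<noteq> 0\<close> by simp
  qed
qed (auto split: if_splits)

lemma smult_sum_right: "smult c (\<Sum>x\<in>A. f x) = (\<Sum>x\<in>A. smult c (f x))"
  by (induction A rule: infinite_finite_induct) (auto simp: smult_add_right)

definition fib_sum :: "int list \<Rightarrow> rat poly" where
  "fib_sum bs = (\<Sum>i\<le>length bs div 2.
     smult ((- 1) ^ i * fib_coeff bs i) (fib_poly (length bs - 2 * i + 1)))"

text \<open>
  With a common index set for all three sums, \<open>z f\<^sub>n = f\<^sub>n\<^sub>+\<^sub>1 - f\<^sub>n\<^sub>-\<^sub>1\<close> splits the first summand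
  on the right into the sums with coefficients \<open>a'\<^sub>i\<close> and, after an index shift that flips the
  sign, \<open>a'\<^sub>i\<^sub>-\<^sub>1\<close>; the same shift applied to the second summand gives the coefficients
  \<open>- a''\<^sub>i\<^sub>-\<^sub>1 / (b b')\<close>.
\<close>

lemma fib_sum_rec:
  assumes "b \<noteq> 0" "b' \<noteq> 0"
  shows "fib_sum (b # b' # bs) =
    [:0, 1:] * fib_sum (b' # bs) + smult (1 / of_int (b * b')) (fib_sum bs)"
proof -
  define n where "n = length bs"
  define N where "N = n div 2"
  define t where "t = 1 / rat_of_int (b * b')"
  \<comment> \<open>Truncated subtraction makes \<open>f i\<close> vanish beyond the range that matters.\<close>
  define f where "f i = fib_poly (n + 3 - 2 * i)" for i
  let ?a = "fib_coeff (b # b' # bs)" and ?a' = "fib_coeff (b' # bs)" and ?a'' = "fib_coeff bs"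
  have fib_sum0: "fib_sum (b # b' # bs) = (\<Sum>i\<le>Suc N. smult ((- 1) ^ i * ?a i) (f i))"
    unfolding fib_sum_def f_def by (intro sum.cong) (auto simp: n_def N_def Suc_diff_le numeral_3_eq_3)
  have fib_sum2: "fib_sum bs = (\<Sum>i\<le>N. smult ((- 1) ^ i * ?a'' i) (f (Suc i)))"
    unfolding fib_sum_def f_def
    by (intro sum.cong) (auto simp: n_def N_def Suc_diff_le numeral_3_eq_3)
  have "fib_sum (b' # bs) =
      (\<Sum>i\<le>Suc n div 2. smult ((- 1) ^ i * ?a' i) (fib_poly (Suc n - 2 * i + 1)))"
    by (simp only: fib_sum_def n_def length_Cons)
  also have "\<dots> =
      (\<Sum>i\<le>Suc N. smult ((- 1) ^ i * ?a' i) (fib_poly (Suc n - 2 * i + 1)))"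
    by (rule sum.mono_neutral_left) (auto simp: n_def N_def fib_coeff_eq_0)
  finally have "[:0, 1:] * fib_sum (b' # bs) =
      (\<Sum>i\<le>Suc N. smult ((- 1) ^ i * ?a' i) ([:0, 1:] * fib_poly (Suc n - 2 * i + 1)))"
    by (simp only: sum_distrib_left mult_smult_right)
  also have "\<dots> = (\<Sum>i\<le>Suc N. smult ((- 1) ^ i * ?a' i) (f i - f (Suc i)))"
  proof (rule sum.cong)
    fix i
    show "smult ((- 1) ^ i * ?a' i) ([:0, 1:] * fib_poly (Suc n - 2 * i + 1)) =
        smult ((- 1) ^ i * ?a' i) (f i - f (Suc i))"
    proof (cases "2 * i \<le> Suc n")
      case True
      then have "n + 3 - 2 * i = Suc (Suc (Suc n - 2 * i))" "n + 3 - 2 * Suc i = Suc n - 2 * i"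
        by auto
      then show ?thesis
        unfolding f_def by simp
    qed (simp add: fib_coeff_eq_0 n_def)
  qed simp
  also have "\<dots> = (\<Sum>i\<le>Suc N. smult ((- 1) ^ i * ?a' i) (f i))
      - (\<Sum>i\<le>Suc N. smult ((- 1) ^ i * ?a' i) (f (Suc i)))"
    by (simp only: smult_diff_right sum_subtractf)
  also have "(\<Sum>i\<le>Suc N. smult ((- 1) ^ i * ?a' i) (f (Suc i))) =
      (\<Sum>i\<le>N. smult ((- 1) ^ i * ?a' i) (f (Suc i)))"
    by (simp add: f_def N_def)
  finally have fib_sum1: "[:0, 1:] * fib_sum (b' # bs) =
      (\<Sum>i\<le>Suc N. smult ((- 1) ^ i * ?a' i) (f i))
      - (\<Sum>i\<le>N. smult ((- 1) ^ i * ?a' i) (f (Suc i)))" .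
  have rec: "?a (Suc i) = ?a' (Suc i) + ?a' i - t * ?a'' i" if "i \<le> N" for i
    using that by (auto simp: t_def N_def n_def)
  have "fib_sum (b # b' # bs) = f 0 +
      (\<Sum>i\<le>N. smult ((- 1) ^ Suc i * (?a' (Suc i) + ?a' i - t * ?a'' i)) (f (Suc i)))"
    unfolding fib_sum0 sum.atMost_Suc_shift
    by (intro arg_cong2[where f = "(+)"] sum.cong)
      (simp_all del: fib_coeff.simps add: rec)
  also have "\<dots> = (f 0 + (\<Sum>i\<le>N. smult ((- 1) ^ Suc i * ?a' (Suc i)) (f (Suc i))))
      - (\<Sum>i\<le>N. smult ((- 1) ^ i * ?a' i) (f (Suc i)))
      + smult t (\<Sum>i\<le>N. smult ((- 1) ^ i * ?a'' i) (f (Suc i)))"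
    by (simp add: smult_sum_right sum.distrib sum_subtractf sum_negf algebra_simps smult_add_left
        smult_diff_left)
  finally show ?thesis
    unfolding fib_sum1 fib_sum2 sum.atMost_Suc_shift[of _ N] t_def by simp
qed

lemma continuant_fib_sum:
  assumes "0 \<notin> set bs"
  shows "map_poly rat_of_int (continuant bs) = smult (of_int (prod_list bs)) (fib_sum bs)"
  using assms
proof (induction bs rule: continuant.induct)
  case (3 b b' bs)
  have "map_poly rat_of_int (continuant (b # b' # bs)) =
      smult (of_int b) ([:0, 1:] * map_poly of_int (continuant (b' # bs)))
        + map_poly of_int (continuant bs)"
    by (rule poly_eqI) (simp add: coeff_map_poly coeff_pCons split: nat.split)
  then show ?case
    using 3 by (simp add: fib_sum_rec smult_add_right field_simps)
qed (auto simp: fib_sum_def map_poly_pCons)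

lemma coeff_fib_poly: "n \<le> k \<Longrightarrow> coeff (fib_poly (Suc n)) k = (if k = n then 1 else 0)"
proof (induction n arbitrary: k rule: fib_poly.induct)
  case (3 n)
  then show ?case
    by (cases k) (auto simp: coeff_pCons)
qed (auto simp: coeff_pCons split: nat.split)

text \<open>
  The Fibonacci polynomials \<open>f\<^sub>m\<^sub>+\<^sub>1, f\<^sub>m\<^sub>-\<^sub>1, \<dots>\<close> are monic of strictly decreasing degree, so the
  coordinates can be read off one after the other, starting from the top.
\<close>

lemma fib_poly_coords_unique:
  fixes g h :: "nat \<Rightarrow> rat"
  assumes "(\<Sum>i\<le>m div 2. smult (g i) (fib_poly (m - 2 * i + 1))) =
           (\<Sum>i\<le>m div 2. smult (h i) (fib_poly (m - 2 * i + 1)))"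
    and "i \<le> m div 2"
  shows "g i = h i"
  using assms(2)
proof (induction i rule: less_induct)
  case (less i)
  have coeff_term: "coeff (smult (g j - h j) (fib_poly (m - 2 * j + 1))) (m - 2 * i) =
      (if j = i then g i - h i else 0)" if "j \<le> m div 2" for j
    using that less by (cases i j rule: linorder_cases) (auto simp: coeff_fib_poly)
  have "0 = coeff (\<Sum>j\<le>m div 2. smult (g j - h j) (fib_poly (m - 2 * j + 1))) (m - 2 * i)"
    using assms(1) by (simp add: smult_diff_left sum_subtractf)
  also have "\<dots> = (\<Sum>j\<le>m div 2. if j = i then g i - h i else 0)"
    unfolding coeff_sum by (intro sum.cong coeff_term) auto
  also have "\<dots> = g i - h i"
    using less.prems by simp
  finally show ?case
    by simp
qed

section \<open>Pairs reached by exchanges and shears\<close>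

text \<open>
  The orbit of \<open>(1, 0)\<close> under the group of \<open>2 \<times> 2\<close> matrices over \<open>\<int>[z]\<close> generated by the exchange
  of coordinates and the elementary matrices with off-diagonal entry \<open>k z\<close>.
\<close>

inductive reachable :: "int poly \<Rightarrow> int poly \<Rightarrow> bool" where
  start: "reachable 1 0"
| swap: "reachable p q \<Longrightarrow> reachable q p"
| shear: "reachable p q \<Longrightarrow> reachable (p + [:0, k:] * q) q"

fun continuant_pair :: "int list \<Rightarrow> int poly \<times> int poly" where
  "continuant_pair [] = (1, 0)"
| "continuant_pair (b # bs) = (continuant (b # bs), continuant bs)"

text \<open>
  A shear that adds to the second entry of a continuant pair lengthens the list; one that adds
  to the first entry alters the head.  If the head thereby becomes zero, the recursion
  \<open>D(0, b', \<dots>) = D(\<dots>)\<close> exhibits the exchanged pair of the shortened list.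
\<close>

lemma reachable_continuant_pair:
  assumes "reachable p q"
  shows "\<exists>bs. 0 \<notin> set bs \<and> ((p, q) = continuant_pair bs \<or> (q, p) = continuant_pair bs)"
  using assms
proof induction
  case start
  show ?case
    by (intro exI[of _ "[]"]) simp
next
  case (swap p q)
  then show ?case
    by blast
next
  case (shear p q k)
  have pair_Cons: "continuant_pair (b # bs) =
      ([:0, b:] * fst (continuant_pair bs) + snd (continuant_pair bs), fst (continuant_pair bs))"
    for b bs by (cases bs) auto
  obtain bs where bs: "0 \<notin> set bs" "(p, q) = continuant_pair bs \<or> (q, p) = continuant_pair bs"
    using shear.IH by blast
  show ?case
  proof (cases "k = 0")
    case True
    then show ?thesis
      using bs by auto
  next
    case False
    show ?thesis
      using bs(2)
    proof
      assume qp: "(q, p) = continuant_pair bs"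
      then have "(p + [:0, k:] * q, q) = continuant_pair (k # bs)"
        unfolding pair_Cons by (simp flip: qp)
      then show ?thesis
        using bs(1) False by (intro exI[of _ "k # bs"]) auto
    next
      assume pq: "(p, q) = continuant_pair bs"
      show ?thesis
      proof (cases bs)
        case Nil
        then show ?thesis
          using bs pq by (intro exI[of _ "[]"]) auto
      next
        case (Cons b cs)
        obtain x y where xy: "continuant_pair cs = (x, y)"
          by fastforce
        have q: "q = x" and p: "p = [:0, b:] * x + y"
          using pq unfolding Cons pair_Cons xy by auto
        have sum: "p + [:0, k:] * q = [:0, b + k:] * x + y"
          unfolding p q by (simp add: algebra_simps smult_add_left)
        show ?thesis
        proof (cases "b + k = 0")
          case True
          then have "(q, p + [:0, k:] * q) = continuant_pair cs"
            unfolding sum using q xy by simp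
          then show ?thesis
            using bs(1) Cons by (intro exI[of _ cs]) auto
        next
          case False
          have "(p + [:0, k:] * q, q) = continuant_pair ((b + k) # cs)"
            unfolding pair_Cons xy fst_conv snd_conv sum[symmetric] by (simp only: q)
          then show ?thesis
            using bs(1) Cons False by (intro exI[of _ "(b + k) # cs"]) auto
        qed
      qed
    qed
  qed
qed

lemma reachable_continuant:
  assumes "reachable p q"
  shows "p = 0 \<or> (\<exists>bs. 0 \<notin> set bs \<and> p = continuant bs)"
proof -
  obtain bs where bs: "0 \<notin> set bs" "(p, q) = continuant_pair bs \<or> (q, p) = continuant_pair bs"
    using reachable_continuant_pair[OF assms] by blast
  then show ?thesis
  proof (cases bs)
    case Nil
    then have "p = 0 \<or> p = continuant []"
      using bs by auto
    then show ?thesis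
      by (metis list.set(1) empty_iff)
  next
    case (Cons b cs)
    then have "p = continuant bs \<or> p = continuant cs" "0 \<notin> set cs"
      using bs by auto
    then show ?thesis
      using bs(1) by auto
  qed
qed

section \<open>Evaluating diagrams slice by slice\<close>

text \<open>
  Slices are deterministic and have a computable effect on the row of orientations.  In this
  form, rewriting decides whether a concrete diagram is an oriented tangle.
\<close>

fun step :: "bool list \<Rightarrow> nat \<times> event \<Rightarrow> bool list option" where
  "step s (i, Cup d) = (if i \<le> length s then Some (take i s @ [d, \<not> d] @ drop i s) else None)"
| "step s (i, Cap) = (if i + 2 \<le> length s \<and> s ! (i + 1) = (\<not> s ! i)
     then Some (take i s @ drop (i + 2) s) else None)"
| "step s (i, Cross e) = (if i + 2 \<le> length s
     then Some (take i s @ [s ! (i + 1), s ! i] @ drop (i + 2) s) else None)"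

lemma split_two:
  assumes "i + 2 \<le> length s"
  shows "s = take i s @ [s ! i, s ! (i + 1)] @ drop (i + 2) s"
  using assms by (metis (no_types, lifting) Cons_nth_drop_Suc add_2_eq_Suc' add_Suc_right append_Cons
      append_Nil append_take_drop_id Suc_eq_plus1 Suc_le_lessD Suc_leD)

lemma slice_iff_step: "slice s x t \<longleftrightarrow> step s x = Some t"
proof
  assume "slice s x t"
  then show "step s x = Some t"
    by cases (auto simp: nth_append)
next
  assume step: "step s x = Some t"
  obtain i g where x: "x = (i, g)"
    by fastforce
  show "slice s x t"
  proof (cases g)
    case (Cup d)
    then show ?thesis
      using step slice.intros(1)[of "take i s" "drop i s" d]
      by (auto simp: x min_def split: if_splits)
  next
    case Cap
    then have "i + 2 \<le> length s" "s ! (i + 1) = (\<not> s ! i)"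
      using step by (auto simp: x split: if_splits)
    then show ?thesis
      using step slice.intros(2)[of "take i s" "s ! i" "drop (i + 2) s"] split_two[of i s] Cap
      by (auto simp: x min_def)
  next
    case (Cross e)
    then have "i + 2 \<le> length s"
      using step by (auto simp: x split: if_splits)
    then show ?thesis
      using step slice.intros(3)[of "take i s" "s ! i" "s ! (i + 1)" "drop (i + 2) s" e]
        split_two[of i s] Cross
      by (auto simp: x min_def)
  qed
qed

lemma tangle_Nil [simp]: "tangle s [] t \<longleftrightarrow> s = t"
  by (auto intro: tangle.intros elim: tangle.cases)

lemma tangle_Cons: "tangle s (x # D) t \<longleftrightarrow> (\<exists>r. step s x = Some r \<and> tangle r D t)"
  by (auto simp flip: slice_iff_step intro: tangle.intros elim: tangle.cases)

lemma tangle_append: "tangle s (D @ D') t \<longleftrightarrow> (\<exists>r. tangle s D r \<and> tangle r D' t)"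
  by (induction D arbitrary: s) (auto simp: tangle_Cons)

lemma tangle_appendI: "tangle s D r \<Longrightarrow> tangle r D' t \<Longrightarrow> tangle s (D @ D') t"
  by (auto simp: tangle_append)

lemma nth_append_Suc_length [simp]: "(xs @ x # y # ys) ! Suc (length xs) = y"
  by (simp add: nth_append)

lemma step_append [simp]:
  "step (u @ v) (length u, Cup d) = Some (u @ d # (\<not> d) # v)"
  "step (u @ a # (\<not> a) # v) (length u, Cap) = Some (u @ v)"
  "step (u @ (\<not> a) # a # v) (length u, Cap) = Some (u @ v)"
  "step (u @ a # b # v) (length u, Cross e) = Some (u @ b # a # v)"
  by (auto simp: nth_append)

definition cups :: "diagram \<Rightarrow> nat" where
  "cups D = length (filter (\<lambda>(i, x). \<exists>d. x = Cup d) D)"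

lemma maxima_simps [simp]:
  "maxima [] = 0" "maxima ((i, Cup d) # D) = maxima D" "maxima ((i, Cap) # D) = Suc (maxima D)"
  "maxima ((i, Cross e) # D) = maxima D"
  by (auto simp: maxima_def)

lemma cups_simps [simp]:
  "cups [] = 0" "cups ((i, Cup d) # D) = Suc (cups D)" "cups ((i, Cap) # D) = cups D"
  "cups ((i, Cross e) # D) = cups D"
  by (auto simp: cups_def)

text \<open>
  Every minimum adds two strands and every maximum removes two.  It follows that no further
  minimum can occur once the number of strands is twice the number of remaining maxima.
\<close>

lemma tangle_width: "tangle s D t \<Longrightarrow> length s + 2 * cups D = length t + 2 * maxima D"
proof (induction D arbitrary: s)
  case (Cons x D)
  obtain i g where x: "x = (i, g)"
    by fastforce
  obtain r where r: "step s x = Some r" "tangle r D t"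
    using Cons.prems by (auto simp: tangle_Cons)
  show ?case
    using r(1) Cons.IH[OF r(2)] by (cases g) (auto simp: x split: if_splits)
qed simp

section \<open>Two basic tangles for each orientation pattern\<close>

text \<open>
  For alternating ends, the two tangles are the two planar matchings.  For the other patterns, one
  of the planar matchings is ruled out by the orientations and is replaced by a matching with a
  single crossing; this crossing is chosen such that the two tangles arise from those of the
  alternating pattern by crossing two antiparallel ends.
\<close>

inductive basis :: "bool list \<Rightarrow> diagram \<Rightarrow> diagram \<Rightarrow> bool" where
  alternating: "basis [a, \<not> a, a, \<not> a]
     [(0, Cup a), (2, Cup a)] [(0, Cup a), (1, Cup (\<not> a))]"
| inner_parallel: "basis [a, \<not> a, \<not> a, a]
     [(0, Cup a), (2, Cup (\<not> a))] [(0, Cup (\<not> a)), (1, Cup a), (0, Cross True)]"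
| outer_parallel: "basis [a, a, \<not> a, \<not> a]
     [(0, Cup a), (2, Cup a), (1, Cross True)] [(0, Cup a), (1, Cup a)]"

section \<open>Consequences of the skein relation and the Reidemeister moves\<close>

locale conway =
  fixes nabla :: "diagram \<Rightarrow> int poly"
  assumes nabla: "conway_polynomial nabla"
begin

text \<open>
  Meant for tangles with upper ends \<open>s\<close>.  Only completions to link diagrams are compared,
  since the axioms for the Conway polynomial say nothing about other lists of slices.
\<close>

definition same_value :: "bool list \<Rightarrow> diagram \<Rightarrow> diagram \<Rightarrow> bool" where
  "same_value s D D' \<longleftrightarrow> (\<forall>F. tangle s F [] \<longrightarrow> nabla (D @ F) = nabla (D' @ F))"

lemma same_value_refl [simp]: "same_value s D D"
  by (simp add: same_value_def)

lemma same_value_sym: "same_value s D D' \<Longrightarrow> same_value s D' D"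
  by (simp add: same_value_def)

lemma same_value_trans [trans]:
  "same_value s D D' \<Longrightarrow> same_value s D' D'' \<Longrightarrow> same_value s D D''"
  by (simp add: same_value_def)

lemma nabla_move:
  assumes "local_move L R" "link_diagram (E @ L @ F)" "link_diagram (E @ R @ F)"
  shows "nabla (E @ L @ F) = nabla (E @ R @ F)"
proof -
  have "isotopic (E @ L @ F) (E @ R @ F)"
    unfolding isotopic_def using assms by (intro r_into_equivclp diagram_move.intros)
  then show ?thesis
    using nabla assms(2) by (auto simp: conway_polynomial_def)
qed

lemma same_value_move:
  assumes "local_move L R" "D = E @ L @ G" "D' = E @ R @ G" "tangle [] D s" "tangle [] D' s"
  shows "same_value s D D'"
  unfolding same_value_def
proof (intro allI impI)
  fix F
  assume "tangle s F []"
  then have "link_diagram (D @ F)" "link_diagram (D' @ F)"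
    using assms(4,5) by (auto simp: link_diagram_def tangle_append)
  then show "nabla (D @ F) = nabla (D' @ F)"
    using nabla_move[OF assms(1), of E "G @ F"] by (simp add: assms(2,3))
qed

lemma same_value_extend:
  assumes "same_value s D D'" "tangle s G t"
  shows "same_value t (D @ G) (D' @ G)"
  using assms unfolding same_value_def by (metis append_assoc tangle_append)

lemma nabla_skein:
  assumes "tangle [] E (u @ a # b # v)" "tangle (u @ b # a # v) F []" "i = length u"
  shows "nabla (E @ (i, Cross (a = b)) # F) - nabla (E @ (i, Cross (a \<noteq> b)) # F)
       = [:0, 1:] * nabla (E @ (if a = b then F else (i, Cap) # (i, Cup b) # F))"
proof -
  have "skein_triple
     (E @ [(i, Cross (a = b))] @ F) (E @ [(i, Cross (a \<noteq> b))] @ F)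
     (E @ (if a = b then [] else [(i, Cap), (i, Cup b)]) @ F)"
    unfolding assms(3) using assms(1,2) by (intro skein_triple.intros) simp_all
  then show ?thesis
    using nabla unfolding conway_polynomial_def by (auto split: if_splits)
qed

text \<open>
  The two crossing signs may be chosen independently, at the price of an integer \<open>k \<in> {-1, 0, 1}\<close>.
  This makes it possible to treat both signs of a crossing at once.
\<close>

lemma skein_antiparallel:
  assumes "tangle [] E (u @ a # (\<not> a) # v)" "i = length u"
  shows "\<exists>k. \<forall>F. tangle (u @ (\<not> a) # a # v) F [] \<longrightarrow>
    nabla (E @ (i, Cross e) # F) = nabla (E @ (i, Cross e') # F)
      + [:0, k:] * nabla (E @ (i, Cap) # (i, Cup (\<not> a)) # F)"
proof -
  consider "e = e'" | "\<not> e" "e'" | "e" "\<not> e'"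
    by blast
  then show ?thesis
  proof cases
    case 1
    then show ?thesis
      by (intro exI[of _ 0]) simp
  next
    case 2
    then show ?thesis
      using nabla_skein[OF assms(1) _ assms(2)]
      by (intro exI[of _ 1]) (auto simp: algebra_simps diff_eq_eq)
  next
    case 3
    then show ?thesis
      using nabla_skein[OF assms(1) _ assms(2)]
      by (intro exI[of _ "-1"]) (auto simp: algebra_simps diff_eq_eq)
  qed
qed

lemma skein_parallel:
  assumes "tangle [] E (u @ a # a # v)" "i = length u"
  shows "\<exists>k. \<forall>F. tangle (u @ a # a # v) F [] \<longrightarrow>
    nabla (E @ (i, Cross e) # F) = nabla (E @ (i, Cross (\<not> e)) # F) + [:0, k:] * nabla (E @ F)"
proof (cases e)
  case True
  then show ?thesis
    using nabla_skein[OF assms(1) _ assms(2)]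
    by (intro exI[of _ 1]) (auto simp: algebra_simps diff_eq_eq)
next
  case False
  then show ?thesis
    using nabla_skein[OF assms(1) _ assms(2)]
    by (intro exI[of _ "-1"]) (auto simp: algebra_simps diff_eq_eq)
qed

lemma nabla_R1_cap:
  assumes "tangle [] E (u @ a # (\<not> a) # v)" "tangle (u @ v) F []" "i = length u"
  shows "nabla (E @ (i, Cross e) # (i, Cap) # F) = nabla (E @ (i, Cap) # F)"
proof -
  have "link_diagram (E @ [(i, Cap)] @ F)" "link_diagram (E @ [(i, Cross e), (i, Cap)] @ F)"
    using assms by (auto simp: link_diagram_def tangle_Cons intro!: tangle_appendI[OF assms(1)])
  then show ?thesis
    using nabla_move[OF R1_cap] by simp
qed

lemma nabla_R1_cup:
  assumes "tangle [] E (u @ v)" "tangle (u @ (\<not> d) # d # v) F []" "i = length u"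
  shows "nabla (E @ (i, Cup d) # (i, Cross e) # F) = nabla (E @ (i, Cup (\<not> d)) # F)"
proof -
  have "link_diagram (E @ [(i, Cup (\<not> d))] @ F)"
    "link_diagram (E @ [(i, Cup d), (i, Cross e)] @ F)"
    using assms by (auto simp: link_diagram_def tangle_Cons intro!: tangle_appendI[OF assms(1)])
  then show ?thesis
    using nabla_move[OF R1_cup] by simp
qed

lemma nabla_circle_flip:
  assumes "tangle [] E (u @ v)" "tangle (u @ v) F []" "i = length u"
  shows "nabla (E @ (i, Cup d) # (i, Cap) # F) = nabla (E @ (i, Cup (\<not> d)) # (i, Cap) # F)"
proof -
  have "tangle [] (E @ [(i, Cup d)]) (u @ d # (\<not> d) # v)"
    using assms by (auto simp: tangle_append tangle_Cons)
  from nabla_R1_cap[OF this assms(2,3), of True]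
  have "nabla (E @ (i, Cup d) # (i, Cross True) # (i, Cap) # F) =
      nabla (E @ (i, Cup d) # (i, Cap) # F)"
    by simp
  moreover have "nabla (E @ (i, Cup d) # (i, Cross True) # (i, Cap) # F) =
      nabla (E @ (i, Cup (\<not> d)) # (i, Cap) # F)"
    using assms by (intro nabla_R1_cup) (auto simp: tangle_Cons)
  ultimately show ?thesis
    by simp
qed

text \<open>
  Let \<open>D\<close> be the rest of the diagram, including the minimum.  Twisting the minimum by a crossing
  of either sign gives \<open>D\<close> again by the first Reidemeister move, and the smoothing of that crossing
  is \<open>D\<close> with a split circle.  The skein relation thus shows that \<open>z\<close> times the value of this
  smoothing is zero.
\<close>

lemma nabla_circle_below_cup:
  assumes "tangle [] E (u @ v)" "tangle (u @ d' # (\<not> d') # v) F []" "i = length u"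
  shows "nabla (E @ (i, Cup d) # (i, Cap) # (i, Cup d') # F) = 0"
proof -
  have E': "tangle [] (E @ [(i, Cup (\<not> d'))]) (u @ (\<not> d') # d' # v)"
    using assms by (auto simp: tangle_append tangle_Cons)
  have "nabla (E @ (i, Cup (\<not> d')) # (i, Cross e) # F) = nabla (E @ (i, Cup d') # F)" for e
    using nabla_R1_cup[OF assms(1), of "\<not> d'" F i e] assms by simp
  then have "[:0, 1:] * nabla (E @ (i, Cup (\<not> d')) # (i, Cap) # (i, Cup d') # F) = 0"
    using nabla_skein[OF E' assms(2,3)] by simp
  then have "nabla (E @ (i, Cup (\<not> d')) # (i, Cap) # (i, Cup d') # F) = 0"
    by simp
  moreover have "tangle (u @ v) ((i, Cup d') # F) []"
    using assms by (simp add: tangle_Cons)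
  ultimately show ?thesis
    using nabla_circle_flip[OF assms(1) _ assms(3), of "(i, Cup d') # F" d]
    by (cases "d = d'") auto
qed

text \<open>
  The same argument with a twisted maximum in place of a minimum.
\<close>

lemma nabla_circle_above_cap:
  assumes "tangle [] E (u @ a # (\<not> a) # v)" "tangle (u @ v) F []" "i = length u"
  shows "nabla (E @ (i, Cap) # (i, Cup (\<not> a)) # (i, Cap) # F) = 0"
proof -
  have "tangle (u @ (\<not> a) # a # v) ((i, Cap) # F) []"
    using assms by (simp add: tangle_Cons)
  then have "[:0, 1:] * nabla (E @ (i, Cap) # (i, Cup (\<not> a)) # (i, Cap) # F) = 0"
    using nabla_skein[OF assms(1) _ assms(3), of "(i, Cap) # F"] nabla_R1_cap[OF assms] by simp
  then show ?thesis
    by simp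
qed

lemma cups_commute:
  "same_value [a, \<not> a, b, \<not> b] [(0, Cup a), (2, Cup b)] [(0, Cup b), (0, Cup a)]"
  by (rule same_value_move[OF far_commute[of 0 "Cup a" 0 "Cup b"], of _ "[]" "[]"])
    (simp_all add: tangle_Cons)

text \<open>
  Crossing the inner legs of two adjacent minima is the same as nesting the minima and crossing
  two neighbouring legs, on the left or on the right.  Comparison of the two sides shows that, on
  the tangles considered here, a crossing of the two rightmost ends acts like one of the two
  leftmost ends.
\<close>

lemma clasp_left:
  "same_value [a, b, \<not> a, \<not> b]
     [(0, Cup a), (2, Cup b), (1, Cross e)] [(0, Cup b), (1, Cup a), (0, Cross (\<not> e))]"
proof -
  have "same_value [a, b, \<not> a, \<not> b]
      [(0, Cup a), (2, Cup b), (1, Cross e)] [(0, Cup b), (0, Cup a), (1, Cross e)]"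
    using same_value_extend[OF cups_commute, of a b "[(1, Cross e)]"] by (simp add: tangle_Cons)
  also have "same_value [a, b, \<not> a, \<not> b]
      [(0, Cup b), (0, Cup a), (1, Cross e)] [(0, Cup b), (1, Cup a), (0, Cross (\<not> e))]"
    by (rule same_value_move[OF slide_cup[of 0 a e], of _ "[(0, Cup b)]" "[]"])
      (simp_all add: tangle_Cons)
  finally show ?thesis .
qed

lemma clasp_right:
  "same_value [a, b, \<not> a, \<not> b]
     [(0, Cup a), (2, Cup b), (1, Cross e)] [(0, Cup a), (1, Cup b), (2, Cross (\<not> e))]"
  by (rule same_value_sym,
      rule same_value_move[OF slide_cup[of 1 b "\<not> e"], of _ "[(0, Cup a)]" "[]"])
    (simp_all add: tangle_Cons)

text \<open>
  As far as the values of completions to link diagrams are concerned, \<open>D\<close> is the linear combination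
  \<open>p X + q Y\<close>.  Existence of a reachable pair suffices: the coordinates need not be unique.
\<close>

definition expands :: "bool list \<Rightarrow> diagram \<Rightarrow> diagram \<Rightarrow> diagram \<Rightarrow> bool" where
  "expands s X Y D \<longleftrightarrow> (\<exists>p q. reachable p q \<and>
     (\<forall>F. tangle s F [] \<longrightarrow> nabla (D @ F) = p * nabla (X @ F) + q * nabla (Y @ F)))"

lemma expands_swap: "expands s X Y D \<Longrightarrow> expands s Y X D"
  unfolding expands_def by (metis add.commute reachable.swap)

text \<open>
  By the skein relation, a crossing \<open>e\<close> sends \<open>X\<close> to \<open>X'\<close> and \<open>Y\<close> to \<open>Y' + k z X'\<close>, where
  \<open>k = 0\<close> if \<open>e = e'\<close>.  The coordinates \<open>(p, q)\<close> become \<open>(p + k z q, q)\<close>.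
\<close>

lemma expands_antiparallel:
  assumes "expands s X Y D" "tangle [] X s" "tangle [] Y s"
    and s: "s = u @ a # (\<not> a) # v" and t: "t = u @ (\<not> a) # a # v" and i: "i = length u"
    and "same_value t (X @ [(i, Cross e')]) X'" "same_value t (Y @ [(i, Cross e')]) Y'"
    and "\<And>F. tangle t F [] \<Longrightarrow> nabla (X @ (i, Cap) # (i, Cup (\<not> a)) # F) = 0"
    and "same_value t (Y @ [(i, Cap), (i, Cup (\<not> a))]) X'"
  shows "expands t X' Y' (D @ [(i, Cross e)])"
proof -
  obtain p q where pq: "reachable p q"
    "\<And>F. tangle s F [] \<Longrightarrow> nabla (D @ F) = p * nabla (X @ F) + q * nabla (Y @ F)"
    using assms(1) unfolding expands_def by blast
  obtain k where k: "\<And>F. tangle t F [] \<Longrightarrow>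
    nabla (X @ (i, Cross e) # F) = nabla (X @ (i, Cross e') # F)
      + [:0, k:] * nabla (X @ (i, Cap) # (i, Cup (\<not> a)) # F)"
    using skein_antiparallel[OF _ i, of X a v e e'] assms(2) s t by blast
  obtain l where l: "\<And>F. tangle t F [] \<Longrightarrow>
    nabla (Y @ (i, Cross e) # F) = nabla (Y @ (i, Cross e') # F)
      + [:0, l:] * nabla (Y @ (i, Cap) # (i, Cup (\<not> a)) # F)"
    using skein_antiparallel[OF _ i, of Y a v e e'] assms(3) s t by blast
  have "nabla ((D @ [(i, Cross e)]) @ F) = (p + [:0, l:] * q) * nabla (X' @ F) + q * nabla (Y' @ F)"
    if F: "tangle t F []" for F
  proof -
    have "tangle s ((i, Cross e) # F) []"
      using F by (simp add: tangle_Cons s t i)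
    then have "nabla ((D @ [(i, Cross e)]) @ F) =
        p * nabla (X @ (i, Cross e) # F) + q * nabla (Y @ (i, Cross e) # F)"
      using pq(2) by simp
    also have "nabla (X @ (i, Cross e) # F) = nabla (X' @ F)"
      using k[OF F] assms(7,9) F by (simp add: same_value_def)
    also have "nabla (Y @ (i, Cross e) # F) = nabla (Y' @ F) + [:0, l:] * nabla (X' @ F)"
      using l[OF F] assms(8,10) F by (simp add: same_value_def)
    finally show ?thesis
      by (simp only: distrib_left distrib_right mult_ac add_ac)
  qed
  then show ?thesis
    unfolding expands_def using reachable.shear[OF pq(1), of l] by blast
qed

text \<open>
  If one crossing takes \<open>X\<close> to \<open>Y\<close>, the opposite one takes \<open>Y\<close> back to \<open>X\<close>.  The smoothing of a
  crossing of parallel strands changes nothing, so the remaining two images differ from these by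
  a multiple of the tangle that is crossed: each crossing acts as an exchange combined with a
  shear.
\<close>

lemma expands_parallel:
  assumes "expands s X Y D" "tangle [] X s" "tangle [] Y s"
    and s: "s = u @ a # a # v" and i: "i = length u"
    and Y: "same_value s (X @ [(i, Cross e')]) Y"
  shows "expands s X Y (D @ [(i, Cross e)])"
proof -
  have cross: "step s (i, Cross f) = Some s" for f
    by (simp add: s i del: step.simps)
  have "same_value s (Y @ [(i, Cross (\<not> e'))]) ((X @ [(i, Cross e')]) @ [(i, Cross (\<not> e'))])"
    by (rule same_value_extend[OF same_value_sym[OF Y]]) (simp add: tangle_Cons cross del: step.simps)
  also have "same_value s ((X @ [(i, Cross e')]) @ [(i, Cross (\<not> e'))]) X"
  proof (rule same_value_move[OF R2[of i e'], of _ X "[]"])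
    show "tangle [] ((X @ [(i, Cross e')]) @ [(i, Cross (\<not> e'))]) s"
      unfolding append_assoc tangle_append[of _ X] using assms(2) cross
      by (intro exI[of _ s]) (simp add: tangle_Cons del: step.simps)
  qed (use assms(2) in simp_all)
  finally have X: "same_value s (Y @ [(i, Cross (\<not> e'))]) X" .
  obtain p q where pq: "reachable p q"
    "\<And>F. tangle s F [] \<Longrightarrow> nabla (D @ F) = p * nabla (X @ F) + q * nabla (Y @ F)"
    using assms(1) unfolding expands_def by blast
  have D: "nabla ((D @ [(i, Cross e)]) @ F) =
        p * nabla (X @ (i, Cross e) # F) + q * nabla (Y @ (i, Cross e) # F)"
    if "tangle s F []" for F
    using pq(2)[of "(i, Cross e) # F"] that cross by (simp add: tangle_Cons del: step.simps)
  show ?thesis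
  proof (cases "e = e'")
    case True
    obtain k where k: "\<And>F. tangle s F [] \<Longrightarrow>
        nabla (Y @ (i, Cross e) # F) = nabla (Y @ (i, Cross (\<not> e)) # F) + [:0, k:] * nabla (Y @ F)"
      using skein_parallel[OF _ i, of Y a v e] assms(3) s by blast
    have "nabla ((D @ [(i, Cross e)]) @ F) = q * nabla (X @ F) + (p + [:0, k:] * q) * nabla (Y @ F)"
      if F: "tangle s F []" for F
    proof -
      have "nabla (X @ (i, Cross e) # F) = nabla (Y @ F)"
        "nabla (Y @ (i, Cross e) # F) = nabla (X @ F) + [:0, k:] * nabla (Y @ F)"
        using X Y k[OF F] F True by (simp_all add: same_value_def)
      then show ?thesis
        using D[OF F] by (simp only: distrib_left distrib_right mult_ac add_ac)
    qed
    then show ?thesis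
      unfolding expands_def using reachable.swap[OF reachable.shear[OF pq(1), of k]] by blast
  next
    case False
    then have e: "e = (\<not> e')"
      by blast
    obtain k where k: "\<And>F. tangle s F [] \<Longrightarrow>
        nabla (X @ (i, Cross e) # F) = nabla (X @ (i, Cross (\<not> e)) # F) + [:0, k:] * nabla (X @ F)"
      using skein_parallel[OF _ i, of X a v e] assms(2) s by blast
    have "nabla ((D @ [(i, Cross e)]) @ F) = (q + [:0, k:] * p) * nabla (X @ F) + p * nabla (Y @ F)"
      if F: "tangle s F []" for F
    proof -
      have "nabla (Y @ (i, Cross e) # F) = nabla (X @ F)"
        "nabla (X @ (i, Cross e) # F) = nabla (Y @ F) + [:0, k:] * nabla (X @ F)"
        using X Y k[OF F] F e by (simp_all add: same_value_def)
      then show ?thesis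
        using D[OF F] by (simp only: distrib_left distrib_right mult_ac add_ac)
    qed
    then show ?thesis
      unfolding expands_def using reachable.shear[OF reachable.swap[OF pq(1)], of k] by blast
  qed
qed

lemma basis_tangle:
  assumes "basis s X Y"
  shows "tangle [] X s" "tangle [] Y s"
  using assms by (auto elim!: basis.cases simp: tangle_Cons)

lemma same_value_moves:
  assumes "tangle [] D s"
  shows
    "D = E @ (i, Cup d) # (i, Cross e) # G \<Longrightarrow> D' = E @ (i, Cup (\<not> d)) # G \<Longrightarrow>
       tangle [] D' s \<Longrightarrow> same_value s D D'"
    "D = E @ (i, Cross e) # (i, Cap) # G \<Longrightarrow> D' = E @ (i, Cap) # G \<Longrightarrow>
       tangle [] D' s \<Longrightarrow> same_value s D D'"
    "D = E @ (i, Cross e) # (i, Cross (\<not> e)) # G \<Longrightarrow> D' = E @ G \<Longrightarrow>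
       tangle [] D' s \<Longrightarrow> same_value s D D'"
    "D = E @ (i, Cup d) # (i + 1, Cap) # G \<Longrightarrow> D' = E @ G \<Longrightarrow>
       tangle [] D' s \<Longrightarrow> same_value s D D'"
    "D = E @ (i + 1, Cup d) # (i, Cap) # G \<Longrightarrow> D' = E @ G \<Longrightarrow>
       tangle [] D' s \<Longrightarrow> same_value s D D'"
  using assms
  by (auto intro: same_value_move[OF R1_cup] same_value_move[OF R1_cap] same_value_move[OF R2]
      same_value_move[OF straighten_left] same_value_move[OF straighten_right])

lemmas same_value_R1_cup = same_value_moves(1)
  and same_value_R1_cap = same_value_moves(2)
  and same_value_R2 = same_value_moves(3)
  and same_value_straighten_left = same_value_moves(4)
  and same_value_straighten_right = same_value_moves(5)

lemma cups_commute_extend: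
  assumes "tangle [a, \<not> a, b, \<not> b] G t"
  shows "same_value t ((0, Cup a) # (2, Cup b) # G) ((0, Cup b) # (0, Cup a) # G)"
  using same_value_extend[OF cups_commute assms] by simp

lemma clasp_right_left_extend:
  assumes "tangle [a, b, \<not> a, \<not> b] G t"
  shows "same_value t ((0, Cup b) # (1, Cup a) # (0, Cross e) # G)
    ((0, Cup a) # (1, Cup b) # (2, Cross e) # G)"
  using same_value_extend[OF same_value_trans[OF same_value_sym[OF clasp_left] clasp_right] assms,
      of "\<not> e"] by simp

text \<open>
  The maximum closes the left minimum to a circle; moving the right minimum above this circle
  reveals that the circle is split.
\<close>

lemma nabla_circle_beside_cup:
  assumes "tangle [c, \<not> c, b, \<not> b] F []"
  shows "nabla ((0, Cup a) # (2, Cup b) # (0, Cap) # (0, Cup c) # F) = 0"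
proof -
  have "same_value [c, \<not> c, b, \<not> b]
      [(0, Cup a), (2, Cup b), (0, Cap), (0, Cup c)] [(0, Cup a), (0, Cap), (0, Cup b), (0, Cup c)]"
    by (rule same_value_sym,
        rule same_value_move[OF far_commute[of 0 Cap 0 "Cup b"], of _ "[(0, Cup a)]" "[(0, Cup c)]"])
      (simp_all add: tangle_Cons)
  then have "nabla ((0, Cup a) # (2, Cup b) # (0, Cap) # (0, Cup c) # F) =
      nabla ((0, Cup a) # (0, Cap) # (0, Cup b) # (0, Cup c) # F)"
    using assms by (simp add: same_value_def)
  also have "\<dots> = 0"
    using nabla_circle_below_cup[of "[]" "[]" "[]" b "(0, Cup c) # F" 0 a] assms
    by (simp add: tangle_Cons)
  finally show ?thesis .
qed

text \<open>
  The three lemmas that follow go through the positions of a crossing.  Outer crossings of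
  alternating ends give the pattern with parallel inner ends, and the middle crossing gives the
  pattern with a parallel pair on either side; in the latter case the roles of
  \<open>X\<close> and \<open>Y\<close> are exchanged, because the middle smoothing turns \<open>X\<close> into \<open>Y\<close> and splits a circle off \<open>Y\<close>.
\<close>

lemma expands_cross_alternating:
  assumes "expands [a, \<not> a, a, \<not> a]
      [(0, Cup a), (2, Cup a)] [(0, Cup a), (1, Cup (\<not> a))] D"
    and "step [a, \<not> a, a, \<not> a] (i, Cross e) = Some t"
  shows "\<exists>X Y. basis t X Y \<and> expands t X Y (D @ [(i, Cross e)])"
proof -
  consider "i = 0" | "i = 1" | "i = 2"
    using assms(2) by (fastforce split: if_splits)
  then show ?thesis
  proof cases
    case 1
    have t: "t = [\<not> a, a, a, \<not> a]"
      using assms(2) 1 by simp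
    have "same_value t [(0, Cup a), (2, Cup a), (0, Cross True)] [(0, Cup (\<not> a)), (2, Cup a)]"
    proof -
      have "same_value t [(0, Cup a), (2, Cup a), (0, Cross True)]
          [(0, Cup a), (0, Cup a), (0, Cross True)]"
        by (rule cups_commute_extend) (simp add: t tangle_Cons)
      also have "same_value t \<dots> [(0, Cup a), (0, Cup (\<not> a))]"
        by (rule same_value_R1_cup[of _ _ "[(0, Cup a)]"]) (auto simp: t tangle_Cons)
      also have "same_value t \<dots> [(0, Cup (\<not> a)), (2, Cup a)]"
        by (rule same_value_sym[OF cups_commute_extend]) (simp add: t tangle_Cons)
      finally show ?thesis .
    qed
    moreover have "same_value t [(0, Cup a), (1, Cup (\<not> a)), (0, Cap), (0, Cup (\<not> a))]
        [(0, Cup (\<not> a)), (2, Cup a)]"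
    proof -
      have "same_value t [(0, Cup a), (1, Cup (\<not> a)), (0, Cap), (0, Cup (\<not> a))]
          [(0, Cup a), (0, Cup (\<not> a))]"
        by (rule same_value_straighten_right[of _ _ "[(0, Cup a)]"]) (auto simp: t tangle_Cons)
      also have "same_value t \<dots> [(0, Cup (\<not> a)), (2, Cup a)]"
        by (rule same_value_sym[OF cups_commute_extend]) (simp add: t tangle_Cons)
      finally show ?thesis .
    qed
    ultimately have "expands t [(0, Cup (\<not> a)), (2, Cup a)]
        [(0, Cup a), (1, Cup (\<not> a)), (0, Cross True)] (D @ [(i, Cross e)])"
      by (intro expands_antiparallel[OF assms(1), where u = "[]" and a = a and e' = True])
        (auto simp: t 1 tangle_Cons nabla_circle_beside_cup)
    then show ?thesis
      using basis.inner_parallel[of "\<not> a"] by (auto simp: t)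
  next
    case 2
    have t: "t = [a, a, \<not> a, \<not> a]"
      using assms(2) 2 by simp
    have "same_value t [(0, Cup a), (1, Cup (\<not> a)), (1, Cross True)] [(0, Cup a), (1, Cup a)]"
      by (rule same_value_R1_cup[of _ _ "[(0, Cup a)]"]) (auto simp: t tangle_Cons)
    moreover have "same_value t [(0, Cup a), (2, Cup a), (1, Cap), (1, Cup a)]
        [(0, Cup a), (1, Cup a)]"
      by (rule same_value_straighten_right[of _ _ "[(0, Cup a)]" 1]) (auto simp: t tangle_Cons)
    moreover have "nabla ((0, Cup a) # (1, Cup (\<not> a)) # (1, Cap) # (1, Cup a) # F) = 0"
      if "tangle t F []" for F
      using that nabla_circle_below_cup[of "[(0, Cup a)]" "[a]" "[\<not> a]" a F 1 "\<not> a"]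
      by (simp add: t tangle_Cons)
    ultimately have "expands t [(0, Cup a), (1, Cup a)]
        [(0, Cup a), (2, Cup a), (1, Cross True)] (D @ [(i, Cross e)])"
      by (intro expands_antiparallel[OF expands_swap[OF assms(1)],
            where u = "[a]" and a = "\<not> a" and e' = True])
        (auto simp: t 2 tangle_Cons)
    then show ?thesis
      using basis.outer_parallel[of a] expands_swap unfolding t by blast
  next
    case 3
    have t: "t = [a, \<not> a, \<not> a, a]"
      using assms(2) 3 by simp
    have "same_value t [(0, Cup a), (2, Cup a), (2, Cross True)] [(0, Cup a), (2, Cup (\<not> a))]"
      by (rule same_value_R1_cup[of _ _ "[(0, Cup a)]"]) (auto simp: t tangle_Cons)
    moreover have "same_value t [(0, Cup a), (1, Cup (\<not> a)), (2, Cross True)]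
        [(0, Cup (\<not> a)), (1, Cup a), (0, Cross True)]"
      by (rule same_value_sym[OF clasp_right_left_extend]) (simp add: t)
    moreover have "same_value t [(0, Cup a), (1, Cup (\<not> a)), (2, Cap), (2, Cup (\<not> a))]
          [(0, Cup a), (2, Cup (\<not> a))]"
      by (rule same_value_straighten_left[of _ _ "[(0, Cup a)]" 1]) (auto simp: t tangle_Cons)
    moreover have "nabla ((0, Cup a) # (2, Cup a) # (2, Cap) # (2, Cup (\<not> a)) # F) = 0"
      if "tangle t F []" for F
      using that nabla_circle_below_cup[of "[(0, Cup a)]" "[a, \<not> a]" "[]" "\<not> a" F 2 a]
      by (simp add: t tangle_Cons)
    ultimately have "expands t [(0, Cup a), (2, Cup (\<not> a))]
        [(0, Cup (\<not> a)), (1, Cup a), (0, Cross True)] (D @ [(i, Cross e)])"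
      by (intro expands_antiparallel[OF assms(1), where u = "[a, \<not> a]" and a = a and e' = True])
        (auto simp: t 3 tangle_Cons)
    then show ?thesis
      using basis.inner_parallel[of a] by (auto simp: t)
  qed
qed

text \<open>
  An outer crossing of sign \<open>False\<close> cancels the crossing contained in \<open>Y\<close> and restores alternating
  ends.  For the crossing of the two rightmost ends, the crossing in \<open>Y\<close> has to be transferred to
  the right first.  The middle crossing is parallel.
\<close>

lemma expands_cross_inner_parallel:
  assumes "expands [a, \<not> a, \<not> a, a]
      [(0, Cup a), (2, Cup (\<not> a))] [(0, Cup (\<not> a)), (1, Cup a), (0, Cross True)] D"
    and "step [a, \<not> a, \<not> a, a] (i, Cross e) = Some t"
  shows "\<exists>X Y. basis t X Y \<and> expands t X Y (D @ [(i, Cross e)])"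
proof -
  consider "i = 0" | "i = 1" | "i = 2"
    using assms(2) by (fastforce split: if_splits)
  then show ?thesis
  proof cases
    case 1
    have t: "t = [\<not> a, a, \<not> a, a]"
      using assms(2) 1 by simp
    have "same_value t [(0, Cup a), (2, Cup (\<not> a)), (0, Cross False)]
        [(0, Cup (\<not> a)), (2, Cup (\<not> a))]"
    proof -
      have "same_value t [(0, Cup a), (2, Cup (\<not> a)), (0, Cross False)]
          [(0, Cup (\<not> a)), (0, Cup a), (0, Cross False)]"
        by (rule cups_commute_extend) (simp add: t tangle_Cons)
      also have "same_value t \<dots> [(0, Cup (\<not> a)), (0, Cup (\<not> a))]"
        by (rule same_value_R1_cup[of _ _ "[(0, Cup (\<not> a))]"]) (auto simp: t tangle_Cons)
      also have "same_value t \<dots> [(0, Cup (\<not> a)), (2, Cup (\<not> a))]"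
        by (rule same_value_sym[OF cups_commute_extend]) (simp add: t tangle_Cons)
      finally show ?thesis .
    qed
    moreover have "same_value t [(0, Cup (\<not> a)), (1, Cup a), (0, Cross True), (0, Cross False)]
        [(0, Cup (\<not> a)), (1, Cup a)]"
      by (rule same_value_R2[of _ _ "[(0, Cup (\<not> a)), (1, Cup a)]"]) (auto simp: t tangle_Cons)
    moreover have "same_value t
        [(0, Cup (\<not> a)), (1, Cup a), (0, Cross True), (0, Cap), (0, Cup (\<not> a))]
        [(0, Cup (\<not> a)), (2, Cup (\<not> a))]"
    proof -
      have "same_value t [(0, Cup (\<not> a)), (1, Cup a), (0, Cross True), (0, Cap), (0, Cup (\<not> a))]
          [(0, Cup (\<not> a)), (1, Cup a), (0, Cap), (0, Cup (\<not> a))]"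
        by (rule same_value_R1_cap[of _ _ "[(0, Cup (\<not> a)), (1, Cup a)]"])
          (auto simp: t tangle_Cons)
      also have "same_value t \<dots> [(0, Cup (\<not> a)), (0, Cup (\<not> a))]"
        by (rule same_value_straighten_right[of _ _ "[(0, Cup (\<not> a))]"]) (auto simp: t tangle_Cons)
      also have "same_value t \<dots> [(0, Cup (\<not> a)), (2, Cup (\<not> a))]"
        by (rule same_value_sym[OF cups_commute_extend]) (simp add: t tangle_Cons)
      finally show ?thesis .
    qed
    ultimately have "expands t [(0, Cup (\<not> a)), (2, Cup (\<not> a))]
        [(0, Cup (\<not> a)), (1, Cup a)] (D @ [(i, Cross e)])"
      by (intro expands_antiparallel[OF assms(1), where u = "[]" and a = a and e' = False])
        (auto simp: t 1 tangle_Cons nabla_circle_beside_cup)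
    then show ?thesis
      using basis.alternating[of "\<not> a"] by (auto simp: t)
  next
    case 2
    have t: "t = [a, \<not> a, \<not> a, a]"
      using assms(2) 2 by simp
    have "same_value t [(0, Cup a), (2, Cup (\<not> a)), (1, Cross False)]
        [(0, Cup (\<not> a)), (1, Cup a), (0, Cross True)]"
      using clasp_left[of a "\<not> a" False] by (simp add: t)
    then have "expands t [(0, Cup a), (2, Cup (\<not> a))]
        [(0, Cup (\<not> a)), (1, Cup a), (0, Cross True)] (D @ [(i, Cross e)])"
      using assms(1) unfolding t
      by (intro expands_parallel[where u = "[a]" and e' = False]) (auto simp: 2 tangle_Cons)
    then show ?thesis
      using basis.inner_parallel[of a] by (auto simp: t)
  next
    case 3
    have t: "t = [a, \<not> a, a, \<not> a]"
      using assms(2) 3 by simp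
    have "same_value t [(0, Cup a), (2, Cup (\<not> a)), (2, Cross False)] [(0, Cup a), (2, Cup a)]"
      by (rule same_value_R1_cup[of _ _ "[(0, Cup a)]"]) (auto simp: t tangle_Cons)
    moreover have "same_value t [(0, Cup (\<not> a)), (1, Cup a), (0, Cross True), (2, Cross False)]
        [(0, Cup a), (1, Cup (\<not> a))]"
    proof -
      have "same_value t [(0, Cup (\<not> a)), (1, Cup a), (0, Cross True), (2, Cross False)]
          [(0, Cup a), (1, Cup (\<not> a)), (2, Cross True), (2, Cross False)]"
        by (rule clasp_right_left_extend) (simp add: t tangle_Cons)
      also have "same_value t \<dots> [(0, Cup a), (1, Cup (\<not> a))]"
        by (rule same_value_R2[of _ _ "[(0, Cup a), (1, Cup (\<not> a))]"]) (auto simp: t tangle_Cons)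
      finally show ?thesis .
    qed
    moreover have "same_value t
        [(0, Cup (\<not> a)), (1, Cup a), (0, Cross True), (2, Cap), (2, Cup a)]
        [(0, Cup a), (2, Cup a)]"
    proof -
      have "same_value t [(0, Cup (\<not> a)), (1, Cup a), (0, Cross True), (2, Cap), (2, Cup a)]
          [(0, Cup a), (1, Cup (\<not> a)), (2, Cross True), (2, Cap), (2, Cup a)]"
        by (rule clasp_right_left_extend) (simp add: t tangle_Cons)
      also have "same_value t \<dots> [(0, Cup a), (1, Cup (\<not> a)), (2, Cap), (2, Cup a)]"
        by (rule same_value_R1_cap[of _ _ "[(0, Cup a), (1, Cup (\<not> a))]"])
          (auto simp: t tangle_Cons)
      also have "same_value t \<dots> [(0, Cup a), (2, Cup a)]"
        by (rule same_value_straighten_left[of _ _ "[(0, Cup a)]" 1]) (auto simp: t tangle_Cons)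
      finally show ?thesis .
    qed
    moreover have "nabla ((0, Cup a) # (2, Cup (\<not> a)) # (2, Cap) # (2, Cup a) # F) = 0"
      if "tangle t F []" for F
      using that nabla_circle_below_cup[of "[(0, Cup a)]" "[a, \<not> a]" "[]" a F 2 "\<not> a"]
      by (simp add: t tangle_Cons)
    ultimately have "expands t [(0, Cup a), (2, Cup a)]
        [(0, Cup a), (1, Cup (\<not> a))] (D @ [(i, Cross e)])"
      by (intro expands_antiparallel[OF assms(1), where u = "[a, \<not> a]" and a = "\<not> a" and e' = False])
        (auto simp: t 3 tangle_Cons)
    then show ?thesis
      using basis.alternating[of a] by (auto simp: t)
  qed
qed

text \<open>
  Here the middle crossing of sign \<open>False\<close> cancels the one in \<open>X\<close>, and the two outer crossings are
  parallel.
\<close>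

lemma expands_cross_outer_parallel:
  assumes "expands [a, a, \<not> a, \<not> a]
      [(0, Cup a), (2, Cup a), (1, Cross True)] [(0, Cup a), (1, Cup a)] D"
    and "step [a, a, \<not> a, \<not> a] (i, Cross e) = Some t"
  shows "\<exists>X Y. basis t X Y \<and> expands t X Y (D @ [(i, Cross e)])"
proof -
  consider "i = 0" | "i = 1" | "i = 2"
    using assms(2) by (fastforce split: if_splits)
  then show ?thesis
  proof cases
    case 1
    have t: "t = [a, a, \<not> a, \<not> a]"
      using assms(2) 1 by simp
    have "same_value t [(0, Cup a), (1, Cup a), (0, Cross False)]
        [(0, Cup a), (2, Cup a), (1, Cross True)]"
      using same_value_sym[OF clasp_left[of a a True]] by (simp add: t)
    then have "expands t [(0, Cup a), (1, Cup a)]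
        [(0, Cup a), (2, Cup a), (1, Cross True)] (D @ [(i, Cross e)])"
      using expands_swap[OF assms(1)] unfolding t
      by (intro expands_parallel[where u = "[]" and e' = False]) (auto simp: 1 tangle_Cons)
    then show ?thesis
      using basis.outer_parallel[of a] expands_swap unfolding t by blast
  next
    case 2
    have t: "t = [a, \<not> a, a, \<not> a]"
      using assms(2) 2 by simp
    have "same_value t [(0, Cup a), (1, Cup a), (1, Cross False)] [(0, Cup a), (1, Cup (\<not> a))]"
      by (rule same_value_R1_cup[of _ _ "[(0, Cup a)]"]) (auto simp: t tangle_Cons)
    moreover have "same_value t [(0, Cup a), (2, Cup a), (1, Cross True), (1, Cross False)]
        [(0, Cup a), (2, Cup a)]"
      by (rule same_value_R2[of _ _ "[(0, Cup a), (2, Cup a)]"]) (auto simp: t tangle_Cons)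
    moreover have "same_value t [(0, Cup a), (2, Cup a), (1, Cross True), (1, Cap), (1, Cup (\<not> a))]
        [(0, Cup a), (1, Cup (\<not> a))]"
    proof -
      have "same_value t [(0, Cup a), (2, Cup a), (1, Cross True), (1, Cap), (1, Cup (\<not> a))]
          [(0, Cup a), (2, Cup a), (1, Cap), (1, Cup (\<not> a))]"
        by (rule same_value_R1_cap[of _ _ "[(0, Cup a), (2, Cup a)]"]) (auto simp: t tangle_Cons)
      also have "same_value t \<dots> [(0, Cup a), (1, Cup (\<not> a))]"
        by (rule same_value_straighten_right[of _ _ "[(0, Cup a)]" 1]) (auto simp: t tangle_Cons)
      finally show ?thesis .
    qed
    moreover have "nabla ((0, Cup a) # (1, Cup a) # (1, Cap) # (1, Cup (\<not> a)) # F) = 0"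
      if "tangle t F []" for F
      using that nabla_circle_below_cup[of "[(0, Cup a)]" "[a]" "[\<not> a]" "\<not> a" F 1 a]
      by (simp add: t tangle_Cons)
    ultimately have "expands t [(0, Cup a), (1, Cup (\<not> a))]
        [(0, Cup a), (2, Cup a)] (D @ [(i, Cross e)])"
      by (intro expands_antiparallel[OF expands_swap[OF assms(1)], where u = "[a]" and a = a and e' = False])
        (auto simp: t 2 tangle_Cons)
    then show ?thesis
      using basis.alternating[of a] expands_swap unfolding t by blast
  next
    case 3
    have t: "t = [a, a, \<not> a, \<not> a]"
      using assms(2) 3 by simp
    have "same_value t [(0, Cup a), (1, Cup a), (2, Cross False)]
        [(0, Cup a), (2, Cup a), (1, Cross True)]"
      using same_value_sym[OF clasp_right[of a a True]] by (simp add: t)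
    then have "expands t [(0, Cup a), (1, Cup a)]
        [(0, Cup a), (2, Cup a), (1, Cross True)] (D @ [(i, Cross e)])"
      using expands_swap[OF assms(1)] unfolding t
      by (intro expands_parallel[where u = "[a, a]" and e' = False]) (auto simp: 3 tangle_Cons)
    then show ?thesis
      using basis.outer_parallel[of a] expands_swap unfolding t by blast
  qed
qed

lemma expands_cross:
  assumes "basis s X Y" "expands s X Y D" "step s (i, Cross e) = Some t"
  shows "\<exists>X' Y'. basis t X' Y' \<and> expands t X' Y' (D @ [(i, Cross e)])"
  using assms(1)
proof cases
  case (alternating a)
  show ?thesis
    by (rule expands_cross_alternating) (use assms alternating in simp_all)
next
  case (inner_parallel a)
  show ?thesis
    by (rule expands_cross_inner_parallel) (use assms inner_parallel in simp_all)
next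
  case (outer_parallel a)
  show ?thesis
    by (rule expands_cross_outer_parallel) (use assms outer_parallel in simp_all)
qed

lemma nabla_unknot: "nabla [(0, Cup a), (0, Cap)] = 1"
proof -
  have "nabla [(0, Cup True), (0, Cap)] = 1"
    using nabla by (simp add: conway_polynomial_def unknot_def)
  moreover have "nabla [(0, Cup False), (0, Cap)] = nabla [(0, Cup True), (0, Cap)]"
    using nabla_circle_flip[of "[]" "[]" "[]" "[]" 0 False] by simp
  ultimately show ?thesis
    by (cases a) auto
qed

lemma nabla_unlink: "nabla [(0, Cup a), (0, Cap), (0, Cup b), (0, Cap)] = 0"
  using nabla_circle_below_cup[of "[]" "[]" "[]" b "[(0, Cap)]" 0 a] by (simp add: tangle_Cons)

lemma same_value_Nil: "same_value [] D D' \<Longrightarrow> nabla D = nabla D'"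
  by (auto simp: same_value_def dest: spec[of _ "[]"])

lemma nabla_two_circles_left: "nabla [(0, Cup a), (2, Cup b), (0, Cap), (0, Cap)] = 0"
proof -
  have "same_value [] [(0, Cup a), (2, Cup b), (0, Cap), (0, Cap)]
      [(0, Cup a), (0, Cap), (0, Cup b), (0, Cap)]"
    by (rule same_value_sym,
        rule same_value_move[OF far_commute[of 0 Cap 0 "Cup b"], of _ "[(0, Cup a)]" "[(0, Cap)]"])
      (simp_all add: tangle_Cons)
  then show ?thesis
    using same_value_Nil nabla_unlink by metis
qed

lemma nabla_two_circles_right: "nabla [(0, Cup a), (2, Cup b), (2, Cap), (0, Cap)] = 0"
proof -
  have "same_value [] [(0, Cup a), (2, Cup b), (2, Cap), (0, Cap)]
      [(0, Cup a), (2, Cup b), (0, Cap), (0, Cap)]"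
    by (rule same_value_sym,
        rule same_value_move[OF far_commute[of 0 Cap 0 Cap], of _ "[(0, Cup a), (2, Cup b)]" "[]"])
      (simp_all add: tangle_Cons)
  then show ?thesis
    using same_value_Nil nabla_two_circles_left by metis
qed

lemma nabla_straighten:
  "nabla [(0, Cup a), (1, Cup (\<not> a)), (0, Cap), (0, Cap)] = 1"
  "nabla [(0, Cup a), (1, Cup (\<not> a)), (2, Cap), (0, Cap)] = 1"
  "nabla [(0, Cup a), (2, Cup a), (1, Cap), (0, Cap)] = 1"
proof -
  have "same_value [] [(0, Cup a), (1, Cup (\<not> a)), (0, Cap), (0, Cap)] [(0, Cup a), (0, Cap)]"
    by (rule same_value_straighten_right[of _ _ "[(0, Cup a)]" 0]) (auto simp: tangle_Cons)
  moreover have "same_value [] [(0, Cup a), (1, Cup (\<not> a)), (2, Cap), (0, Cap)] [(0, Cup a), (0, Cap)]"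
    by (rule same_value_straighten_left[of _ _ "[(0, Cup a)]" 1]) (auto simp: tangle_Cons)
  moreover have "same_value [] [(0, Cup a), (2, Cup a), (1, Cap), (0, Cap)] [(0, Cup a), (0, Cap)]"
    by (rule same_value_straighten_right[of _ _ "[(0, Cup a)]" 1]) (auto simp: tangle_Cons)
  ultimately show
    "nabla [(0, Cup a), (1, Cup (\<not> a)), (0, Cap), (0, Cap)] = 1"
    "nabla [(0, Cup a), (1, Cup (\<not> a)), (2, Cap), (0, Cap)] = 1"
    "nabla [(0, Cup a), (2, Cup a), (1, Cap), (0, Cap)] = 1"
    by (auto dest!: same_value_Nil simp: nabla_unknot)
qed

text \<open>
  A bend is inserted into the outer circle such that the inner one lies directly above one of its
  maxima; there it can be split off.
\<close>

lemma nabla_nested_circles: "nabla [(0, Cup a), (1, Cup b), (1, Cap), (0, Cap)] = 0"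
proof -
  have "same_value [] [(0, Cup a), (2, Cup a), (1, Cap), (1, Cup a), (1, Cap), (0, Cap)]
      [(0, Cup a), (1, Cup a), (1, Cap), (0, Cap)]"
    by (rule same_value_straighten_right[of _ _ "[(0, Cup a)]" 1]) (auto simp: tangle_Cons)
  moreover have "nabla [(0, Cup a), (2, Cup a), (1, Cap), (1, Cup a), (1, Cap), (0, Cap)] = 0"
    using nabla_circle_above_cap[of "[(0, Cup a), (2, Cup a)]" "[a]" "\<not> a" "[\<not> a]" "[(0, Cap)]" 1]
    by (simp add: tangle_Cons)
  ultimately have "nabla [(0, Cup a), (1, Cup a), (1, Cap), (0, Cap)] = 0"
    using same_value_Nil by metis
  moreover have "nabla [(0, Cup a), (1, Cup a), (1, Cap), (0, Cap)] =
      nabla [(0, Cup a), (1, Cup (\<not> a)), (1, Cap), (0, Cap)]"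
    using nabla_circle_flip[of "[(0, Cup a)]" "[a]" "[\<not> a]" "[(0, Cap)]" 1 a]
    by (simp add: tangle_Cons)
  ultimately show ?thesis
    by (cases "b = a") auto
qed

section \<open>Reading a diagram with two maxima\<close>

lemma basis_cap:
  assumes "basis s X Y" "step s (i, Cap) = Some t"
  shows "(i = 0 \<or> i = 1 \<or> i = 2) \<and> (\<exists>a. t = [a, \<not> a])"
proof -
  have "length s = 4"
    using assms(1) by (auto elim!: basis.cases)
  then have "i = 0 \<or> i = 1 \<or> i = 2"
    using assms(2) by (auto split: if_splits)
  then show ?thesis
    using assms by (auto elim!: basis.cases split: if_splits)
qed

text \<open>
  A pair of maxima that respects the orientations joins one of the two basic tangles to an unknot
  and the other one to an unlink of two components.
\<close>

lemma expands_closure: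
  assumes "basis s X Y" "expands s X Y D" "step s (i, Cap) = Some t"
  shows "\<exists>q. reachable (nabla (D @ [(i, Cap), (0, Cap)])) q"
proof -
  obtain p q where pq: "reachable p q"
    "\<And>F. tangle s F [] \<Longrightarrow> nabla (D @ F) = p * nabla (X @ F) + q * nabla (Y @ F)"
    using assms(2) unfolding expands_def by blast
  let ?v = "\<lambda>E. nabla (E @ [(i, Cap), (0, Cap)])"
  have i: "i = 0 \<or> i = 1 \<or> i = 2"
    using basis_cap[OF assms(1,3)] by simp
  have "?v X = 0 \<and> ?v Y = 1 \<or> ?v X = 1 \<and> ?v Y = 0"
    using assms(1)
  proof cases
    case (alternating a)
    then show ?thesis
      using i nabla_two_circles_left[of a a] nabla_two_circles_right[of a a]
        nabla_straighten[of a] nabla_nested_circles[of a "\<not> a"] by auto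
  next
    case (inner_parallel a)
    have "i \<noteq> 1"
      using inner_parallel assms(3) by auto
    have "same_value [] [(0, Cup (\<not> a)), (1, Cup a), (0, Cross True), (0, Cap), (0, Cap)]
        [(0, Cup (\<not> a)), (1, Cup a), (0, Cap), (0, Cap)]"
      by (rule same_value_R1_cap[of _ _ "[(0, Cup (\<not> a)), (1, Cup a)]"]) (auto simp: tangle_Cons)
    then have *: "nabla [(0, Cup (\<not> a)), (1, Cup a), (0, Cross True), (0, Cap), (0, Cap)] = 1"
      using nabla_straighten(1)[of "\<not> a"] by (auto dest!: same_value_Nil)
    have "same_value [] [(0, Cup (\<not> a)), (1, Cup a), (0, Cross True), (2, Cap), (0, Cap)]
        [(0, Cup a), (1, Cup (\<not> a)), (2, Cross True), (2, Cap), (0, Cap)]"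
      by (rule clasp_right_left_extend) (simp add: tangle_Cons)
    also have "same_value [] \<dots> [(0, Cup a), (1, Cup (\<not> a)), (2, Cap), (0, Cap)]"
      by (rule same_value_R1_cap[of _ _ "[(0, Cup a), (1, Cup (\<not> a))]"]) (auto simp: tangle_Cons)
    finally have "nabla [(0, Cup (\<not> a)), (1, Cup a), (0, Cross True), (2, Cap), (0, Cap)] = 1"
      using nabla_straighten(2)[of a] by (auto dest!: same_value_Nil)
    then show ?thesis
      using * i \<open>i \<noteq> 1\<close> inner_parallel nabla_two_circles_left[of a "\<not> a"]
        nabla_two_circles_right[of a "\<not> a"] by auto
  next
    case (outer_parallel a)
    have "i = 1"
      using outer_parallel assms(3) i by auto
    have "same_value [] [(0, Cup a), (2, Cup a), (1, Cross True), (1, Cap), (0, Cap)]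
        [(0, Cup a), (2, Cup a), (1, Cap), (0, Cap)]"
      by (rule same_value_R1_cap[of _ _ "[(0, Cup a), (2, Cup a)]"]) (auto simp: tangle_Cons)
    then show ?thesis
      using \<open>i = 1\<close> outer_parallel nabla_straighten(3)[of a] nabla_nested_circles[of a a]
      by (auto dest!: same_value_Nil)
  qed
  moreover have "tangle s [(i, Cap), (0, Cap)] []"
    using assms(1,3) i by (auto elim!: basis.cases simp: tangle_Cons)
  ultimately have "nabla (D @ [(i, Cap), (0, Cap)]) \<in> {p, q}"
    using pq(2) by auto
  then show ?thesis
    using pq(1) reachable.swap by blast
qed

text \<open>
  A two-strand diagram with a single maximum ends with that maximum, and all crossings before it
  are kinks.
\<close>

lemma nabla_last_cap:
  assumes "tangle [] E [a, \<not> a]" "tangle [a, \<not> a] F []" "maxima F = 1"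
  shows "nabla (E @ F) = nabla (E @ [(0, Cap)])"
  using assms
proof (induction F arbitrary: E a)
  case (Cons x F)
  obtain i g where x: "x = (i, g)"
    by fastforce
  obtain t where t: "step [a, \<not> a] x = Some t" "tangle t F []"
    using Cons.prems(2) by (auto simp: tangle_Cons)
  have "cups (x # F) = 0"
    using tangle_width[OF Cons.prems(2)] Cons.prems by simp
  show ?case
  proof (cases g)
    case (Cup d)
    then show ?thesis
      using \<open>cups (x # F) = 0\<close> by (simp add: x)
  next
    case Cap
    then have "i = 0" "t = []"
      using t(1) by (auto simp: x split: if_splits)
    moreover have "F = []"
    proof (cases F)
      case (Cons y F')
      obtain j h where "y = (j, h)"
        by fastforce
      then show ?thesis
        using t(2) \<open>cups (x # F) = 0\<close> \<open>t = []\<close> Cons Cap by (cases h) (auto simp: x tangle_Cons)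
    qed
    ultimately show ?thesis
      by (simp add: x Cap)
  next
    case (Cross e)
    then have i: "i = 0" and t': "t = [\<not> a, \<not> \<not> a]"
      using t(1) by (auto simp: x split: if_splits)
    have "tangle [] (E @ [x]) t"
      using Cons.prems(1) t(1) by (auto intro!: tangle_appendI simp: tangle_Cons)
    then have "nabla ((E @ [x]) @ F) = nabla ((E @ [x]) @ [(0, Cap)])"
      using t(2) Cons.prems(3) unfolding t' by (intro Cons.IH[of "E @ [x]" "\<not> a"]) (simp_all add: x Cross)
    then show ?thesis
      using nabla_R1_cap[of E "[]" a "[]" "[]" 0 e] Cons.prems(1) by (simp add: x i Cross)
  qed
qed simp

text \<open>
  By the count of strands and maxima, no minimum can follow: the diagram continues with crossings
  of four strands, then has a maximum, kinks and the last maximum.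
\<close>

lemma nabla_width_four:
  assumes "basis s X Y" "expands s X Y D" "tangle [] D s" "tangle s F []" "maxima F = 2"
  shows "\<exists>q. reachable (nabla (D @ F)) q"
  using assms
proof (induction F arbitrary: D s X Y)
  case (Cons x F)
  obtain i g where x: "x = (i, g)"
    by fastforce
  obtain t where t: "step s x = Some t" "tangle t F []"
    using Cons.prems(4) by (auto simp: tangle_Cons)
  have Dx: "tangle [] (D @ [x]) t"
    using Cons.prems(3) t(1) by (auto intro!: tangle_appendI simp: tangle_Cons)
  have "length s = 4"
    using Cons.prems(1) by (auto elim!: basis.cases)
  then have "cups (x # F) = 0"
    using tangle_width[OF Cons.prems(4)] Cons.prems(5) by simp
  show ?case
  proof (cases g)
    case (Cup d)
    then show ?thesis
      using \<open>cups (x # F) = 0\<close> by (simp add: x)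
  next
    case Cap
    obtain a where "t = [a, \<not> a]"
      using basis_cap[OF Cons.prems(1)] t(1) by (auto simp: x Cap)
    then have "nabla ((D @ [x]) @ F) = nabla ((D @ [x]) @ [(0, Cap)])"
      using Dx t(2) Cons.prems(5) by (intro nabla_last_cap) (simp_all add: x Cap)
    then show ?thesis
      using expands_closure[OF Cons.prems(1,2)] t(1) by (simp add: x Cap)
  next
    case (Cross e)
    obtain X' Y' where "basis t X' Y'" "expands t X' Y' (D @ [x])"
      using expands_cross[OF Cons.prems(1,2)] t(1) unfolding x Cross by blast
    then show ?thesis
      using Cons.IH[of t X' Y' "D @ [x]"] Dx t(2) Cons.prems(5) by (simp add: x Cross)
  qed
qed simp

lemma expands_basis:
  "expands s X Y X" "expands s X Y Y"
  using reachable.start reachable.swap[OF reachable.start] by (force simp: expands_def)+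

lemma expands_two_cups:
  assumes "step [a, \<not> a] (i, Cup d) = Some t"
  shows "\<exists>X Y D. basis t X Y \<and> expands t X Y D \<and> tangle [] D t \<and>
    same_value t [(0, Cup a), (i, Cup d)] D"
proof -
  have "\<exists>X Y D. basis t X Y \<and> D \<in> {X, Y} \<and> same_value t [(0, Cup a), (i, Cup d)] D"
  proof -
    have beside: "\<exists>Y. basis [b, \<not> b, c, \<not> c] [(0, Cup b), (2, Cup c)] Y" for b c
      using basis.alternating[of b] basis.inner_parallel[of b] by (cases "b = c") auto
    consider "i = 0" | "i = 1" | "i = 2"
      using assms by (fastforce split: if_splits)
    then show ?thesis
    proof cases
      case 1
      then have t: "t = [d, \<not> d, a, \<not> a]"
        using assms by simp
      show ?thesis
        using beside[of d a] same_value_sym[OF cups_commute[of d a]] unfolding t 1 by blast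
    next
      case 2
      then have "t = [a, d, \<not> d, \<not> a]"
        using assms by simp
      then show ?thesis
        using basis.outer_parallel[of a] basis.alternating[of a] same_value_refl 2
        by (cases "a = d") fastforce+
    next
      case 3
      then have t: "t = [a, \<not> a, d, \<not> d]"
        using assms by simp
      show ?thesis
        using beside[of a d] same_value_refl unfolding t 3 by blast
    qed
  qed
  then show ?thesis
    using expands_basis basis_tangle by blast
qed

text \<open>
  Above the first minimum, crossings are kinks that merely reverse its orientation.  A second
  minimum leads to the four-strand case, and a maximum closes the diagram to a circle that is
  split from the rest.
\<close>

lemma nabla_width_two:
  assumes "tangle [a, \<not> a] F []" "maxima F = 2"
  shows "\<exists>q. reachable (nabla ((0, Cup a) # F)) q"
  using assms
proof (induction F arbitrary: a)
  case (Cons x F)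
  obtain i g where x: "x = (i, g)"
    by fastforce
  obtain t where t: "step [a, \<not> a] x = Some t" "tangle t F []"
    using Cons.prems(1) by (auto simp: tangle_Cons)
  show ?case
  proof (cases g)
    case (Cup d)
    obtain X Y D where D: "basis t X Y" "expands t X Y D" "tangle [] D t"
      "same_value t [(0, Cup a), (i, Cup d)] D"
      using expands_two_cups t(1) unfolding x Cup by blast
    have "nabla ([(0, Cup a), (i, Cup d)] @ F) = nabla (D @ F)"
      using D(4) t(2) unfolding same_value_def by blast
    then show ?thesis
      using nabla_width_four[OF D(1-3) t(2)] Cons.prems(2) by (simp add: x Cup)
  next
    case Cap
    then have i: "i = 0" and "t = []"
      using t(1) by (auto simp: x split: if_splits)
    have "maxima F = 1"
      using Cons.prems(2) by (simp add: x Cap)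
    then obtain j h F' where F: "F = (j, h) # F'"
      by (cases F) auto
    then obtain b where b: "j = 0" "h = Cup b" "tangle [b, \<not> b] F' []"
      using t(2) \<open>t = []\<close> by (cases h) (auto simp: tangle_Cons split: if_splits)
    have "nabla ([(0, Cup a), (0, Cap), (0, Cup b)] @ F') =
        nabla ([(0, Cup a), (0, Cap), (0, Cup b)] @ [(0, Cap)])"
      by (rule nabla_last_cap) (use b \<open>maxima F = 1\<close> F in \<open>simp_all add: tangle_Cons\<close>)
    then have "nabla ((0, Cup a) # x # F) = 0"
      using nabla_unlink by (simp add: x i Cap F b)
    then show ?thesis
      using reachable.swap[OF reachable.start] by auto
  next
    case (Cross e)
    then have i: "i = 0" and t': "t = [\<not> a, \<not> \<not> a]"
      using t(1) by (auto simp: x split: if_splits)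
    have "nabla ((0, Cup a) # x # F) = nabla ((0, Cup (\<not> a)) # F)"
      using nabla_R1_cup[of "[]" "[]" "[]" a F 0 e] t(2) by (simp add: x i Cross t')
    then show ?thesis
      using Cons.IH[of "\<not> a"] t(2) Cons.prems(2) by (simp add: x Cross t')
  qed
qed simp

text \<open>
  Isotopy is reflexive on all lists of slices, but its nontrivial steps connect link diagrams only.
\<close>

lemma isotopic_link_diagram:
  assumes "isotopic D D'" "link_diagram D"
  shows "link_diagram D'"
  using assms unfolding isotopic_def
  by (induction rule: equivclp_induct) (auto elim: diagram_move.cases)

lemma two_bridge_reachable:
  assumes "two_bridge K"
  shows "\<exists>q. reachable (nabla K) q"
proof -
  obtain D where D: "link_diagram K" "isotopic K D" "maxima D = 2"
    using assms by (auto simp: two_bridge_def)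
  have "link_diagram D"
    using isotopic_link_diagram[OF D(2,1)] .
  obtain i g F where F: "D = (i, g) # F"
    using D(3) by (cases D) auto
  then obtain a where "i = 0" "g = Cup a" "tangle [a, \<not> a] F []"
    using \<open>link_diagram D\<close> by (cases g) (auto simp: link_diagram_def tangle_Cons split: if_splits)
  then have "\<exists>q. reachable (nabla D) q"
    using nabla_width_two D(3) F by simp
  moreover have "nabla K = nabla D"
    using nabla D by (auto simp: conway_polynomial_def)
  ultimately show ?thesis
    by simp
qed

end

theorem theorem4p6:
  fixes nabla :: "diagram \<Rightarrow> int poly" and K :: diagram
    and m :: nat and c :: int and \<alpha> :: "nat \<Rightarrow> rat"
  assumes "conway_polynomial nabla"
    and "two_bridge K"
    and "m = degree (nabla K)"
    and "c = lead_coeff (nabla K)"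
    and "\<alpha> 0 = 1"
    and "map_poly rat_of_int (nabla K) =
           smult (rat_of_int c)
             (\<Sum>i = 0..m div 2. smult ((- 1) ^ i * \<alpha> i) (fib_poly (m - 2 * i + 1)))"
  shows "(\<forall>j \<le> m div 2. \<alpha> j \<ge> 0) \<and>
         (\<forall>i. 0 < i \<and> i \<le> m div 2 \<and> \<alpha> i = 0 \<longrightarrow> (\<forall>j. i \<le> j \<and> j \<le> m div 2 \<longrightarrow> \<alpha> j = 0))"
proof -
  interpret conway nabla
    by unfold_locales fact
  obtain q where "reachable (nabla K) q"
    using two_bridge_reachable[OF assms(2)] by blast
  then consider "nabla K = 0" | bs where "0 \<notin> set bs" "nabla K = continuant bs"
    using reachable_continuant by blast
  then show ?thesis
  proof cases
    \<comment> \<open>The value zero, taken by the unlink of two components: the only coefficient is \<open>\<alpha> 0 = 1\<close>.\<close>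
    case 1
    then have "m = 0"
      using assms(3) by simp
    then show ?thesis
      using assms(5) by simp
  next
    case (2 bs)
    have m: "m = length bs" and c: "c = prod_list bs"
      using assms(3,4) continuant_degree_lead_coeff[OF 2(1)] 2(2) by simp_all
    have "c \<noteq> 0"
      using 2(1) by (simp add: c prod_list_zero_iff)
    have "smult (rat_of_int c)
        (\<Sum>i = 0..m div 2. smult ((- 1) ^ i * \<alpha> i) (fib_poly (m - 2 * i + 1))) =
        smult (rat_of_int c) (fib_sum bs)"
      using assms(6) continuant_fib_sum[OF 2(1)] by (simp add: 2(2) c)
    then have "smult (rat_of_int c)
        ((\<Sum>i = 0..m div 2. smult ((- 1) ^ i * \<alpha> i) (fib_poly (m - 2 * i + 1)))
          - fib_sum bs) = 0"
      unfolding smult_diff_right by simp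
    then have "(\<Sum>i = 0..m div 2. smult ((- 1) ^ i * \<alpha> i) (fib_poly (m - 2 * i + 1)))
        = fib_sum bs"
      using \<open>c \<noteq> 0\<close> unfolding smult_eq_0_iff by simp
    then have "(\<Sum>i\<le>m div 2. smult ((- 1) ^ i * \<alpha> i) (fib_poly (m - 2 * i + 1))) =
        (\<Sum>i\<le>m div 2. smult ((- 1) ^ i * fib_coeff bs i) (fib_poly (m - 2 * i + 1)))"
      unfolding fib_sum_def m atMost_atLeast0 .
    then have "(- 1) ^ i * \<alpha> i = (- 1) ^ i * fib_coeff bs i" if "i \<le> m div 2" for i
      using that by (rule fib_poly_coords_unique)
    then have \<alpha>: "\<alpha> i = fib_coeff bs i" if "i \<le> m div 2" for i
      using that by fastforce
    show ?thesis
      using \<alpha> fib_coeff_mono[OF 2(1)] fib_coeff_zero_tail[OF 2(1)] by (metis order.trans)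
  qed
qed

end
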